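(* Let $n\ge 1$, $T>0$, $\mathbf Z^0\in(\mathbb R^2)^n$, and let $E\in C^1((\mathbb R^2)^n)$ be a real-valued function such that $E$ and $\nabla E$ are bounded and uniformly continuous. For every $\tau>0$, let $(\mathbf Z_\tau^k)_{k=0}^{\lceil T/\tau\rceil}$ be a solution to the $D$-minimising-movement scheme, i.e. $$\mathbf Z_\tau^0=\mathbf Z^0,\qquad \mathbf Z_\tau^{k+1}\in\operatorname*{arg\,min}_{\mathbf X\in(\mathbb R^2)^n}\left[\frac{D^2(\mathbf Z_\tau^k,\mathbf X)}{2\tau}+E(\mathbf X)\right],\quad k=0,\dots,\lceil T/\tau\rceil-1,$$ and let $\overline{\mathbf Z}_\tau:[0,T]\to(\mathbb R^2)^n$ be the step function $\overline{\mathbf Z}_\tau(t):=\mathbf Z_\tau^k$ for $t\in((k-1)\tau,k\tau]$. Then, along a subsequence of $\tau\to0$ (that is, every sequence $\tau_j\downarrow 0$ has a subsequence, not relabelled, for which the following holds), the curves $\overline{\mathbf Z}_{\tau_j}(t)$ converge pointwise for all $t\in[0,T]$ to an absolutely continuous curve $\hat{\mathbf Z}:[0,T]\to(\mathbb R^2)^n$ which satisfies the energy-dissipation inequality $$E(\hat{\mathbf Z}(T))-E(\hat{\mathbf Z}(0))+\frac12\int_0^T\left(|\hat{\mathbf Z}'|_{\hat D}^2(t)+|\partial E|_{\hat D}^2(\hat{\mathbf Z}(t))\right)dt\le 0.$$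
   Context: Glide directions: $\mathcal G=\{\mathbf g_1,\dots,\mathbf g_N\}\subset\mathbb S^1\subset\mathbb R^2$ is a fixed finite set of $N$ unit vectors ($N$ even) such that $\mathbf g\in\mathcal G$ implies $-\mathbf g\in\mathcal G$, and $\operatorname{span}\mathcal G=\mathbb R^2$. Write $\mathbb R\mathcal G=\{r\mathbf g: r\in\mathbb R,\ \mathbf g\in\mathcal G\}$, and let $|\cdot|$ be the Euclidean norm. Elements of $(\mathbb R^2)^n$ are written $\mathbf X=(\mathbf x_1,\dots,\mathbf x_n)$ with $\mathbf x_i\in\mathbb R^2$. Quasi-distance $D$ (not a metric in general): for $\mathbf x,\mathbf y\in\mathbb R^2$ set $d(\mathbf x,\mathbf y)=|\mathbf x-\mathbf y|$ if $\mathbf x-\mathbf y\in\mathbb R\mathcal G$ and $d(\mathbf x,\mathbf y)=\infty$ otherwise; for $\mathbf X,\mathbf Y\in(\mathbb R^2)^n$ let $D(\mathbf X,\mathbf Y)\in[0,\infty]$ be given by $D^2(\mathbf X,\mathbf Y)=\sum_{i=1}^n d^2(\mathbf x_i,\mathbf y_i)$. Crystalline norm and metric $\hat D$: for $\mathbf x\in\mathbb R^2$, $\|\mathbf x\|:=\inf\{\alpha+\beta : \alpha,\beta\ge0 \text{ and there exist } \mathbf g,\tilde{\mathbf g}\in\mathcal G \text{ with } \mathbf x=\alpha\mathbf g+\beta\tilde{\mathbf g}\}$; and $\hat D(\mathbf X,\mathbf Y)\in[0,\infty)$ is given by $\hat D^2(\mathbf X,\mathbf Y)=\sum_{i=1}^n\|\mathbf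 x_i-\mathbf y_i\|^2$. Right metric derivative and metric slope with respect to $\hat D$: $$|\mathbf Z'|_{\hat D}(t):=\lim_{s\downarrow t}\frac{\hat D(\mathbf Z(s),\mathbf Z(t))}{s-t},\qquad |\partial E|_{\hat D}(\mathbf Z):=\limsup_{\mathbf X\to\mathbf Z}\frac{E(\mathbf Z)-E(\mathbf X)}{\hat D(\mathbf X,\mathbf Z)}.$$ The metric derivative of an absolutely continuous curve is defined for a.e. $t\in(0,T)$. *)

theory Defs
  imports "HOL-Analysis.Analysis"
begin

definition glide_directions :: "(real^2) set \<Rightarrow> bool" where
  "glide_directions G \<longleftrightarrow>
     finite G \<and> even (card G) \<and> (\<forall>g\<in>G. norm g = 1) \<and> (\<forall>g\<in>G. - g \<in> G) \<and> span G = UNIV"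

definition glide_lines :: "(real^2) set \<Rightarrow> (real^2) set" where
  "glide_lines G = {r *\<^sub>R g | r g. g \<in> G}"

definition glide_dist1 :: "(real^2) set \<Rightarrow> real^2 \<Rightarrow> real^2 \<Rightarrow> ereal" where
  "glide_dist1 G x y = (if x - y \<in> glide_lines G then ereal (norm (x - y)) else \<infinity>)"

text \<open>The extended reals have no square root in the library, so the infinite case is split off;
  \<open>glide_dist_squared\<close> below is the defining equation.\<close>

definition glide_dist :: "(real^2) set \<Rightarrow> (real^2)^'n \<Rightarrow> (real^2)^'n \<Rightarrow> ereal" where
  "glide_dist G X Y =
     (if \<forall>i. glide_dist1 G (X $ i) (Y $ i) \<noteq> \<infinity>
      then ereal (sqrt (\<Sum>i\<in>UNIV. (real_of_ereal (glide_dist1 G (X $ i) (Y $ i)))\<^sup>2))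
      else \<infinity>)"

lemma glide_dist_nonneg: "0 \<le> glide_dist G X Y"
  by (simp add: glide_dist_def sum_nonneg)

lemma glide_dist_squared:
  "(glide_dist G X Y)\<^sup>2 = (\<Sum>i\<in>UNIV. (glide_dist1 G (X $ i) (Y $ i))\<^sup>2)"
proof (cases "\<forall>i. glide_dist1 G (X $ i) (Y $ i) \<noteq> \<infinity>")
  case True
  have fin: "(glide_dist1 G (X $ i) (Y $ i))\<^sup>2
      = ereal ((real_of_ereal (glide_dist1 G (X $ i) (Y $ i)))\<^sup>2)" for i
    using True[rule_format, of i] by (auto simp: glide_dist1_def split: if_splits)
  have "(\<Sum>i\<in>UNIV. (glide_dist1 G (X $ i) (Y $ i))\<^sup>2)
      = ereal (\<Sum>i\<in>UNIV. (real_of_ereal (glide_dist1 G (X $ i) (Y $ i)))\<^sup>2)"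
    by (simp add: fin)
  then show ?thesis
    using True by (simp add: glide_dist_def sum_nonneg)
next
  case False
  then obtain i where "glide_dist1 G (X $ i) (Y $ i) = \<infinity>" by auto
  then have "(glide_dist1 G (X $ i) (Y $ i))\<^sup>2 = \<infinity>" by (simp add: power2_eq_square)
  then have "(\<Sum>i\<in>UNIV. (glide_dist1 G (X $ i) (Y $ i))\<^sup>2) = \<infinity>"
    unfolding sum_Pinfty by auto
  with False show ?thesis by (simp add: glide_dist_def power2_eq_square)
qed

definition crystalline_norm :: "(real^2) set \<Rightarrow> real^2 \<Rightarrow> real" where
  "crystalline_norm G x =
     Inf {a + b | a b. 0 \<le> a \<and> 0 \<le> b \<and> (\<exists>g\<in>G. \<exists>h\<in>G. x = a *\<^sub>R g + b *\<^sub>R h)}"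

definition crystalline_dist :: "(real^2) set \<Rightarrow> (real^2)^'n \<Rightarrow> (real^2)^'n \<Rightarrow> real" where
  "crystalline_dist G X Y = sqrt (\<Sum>i\<in>UNIV. (crystalline_norm G (X $ i - Y $ i))\<^sup>2)"

definition metric_quotient ::
    "(real^2) set \<Rightarrow> (real \<Rightarrow> (real^2)^'n) \<Rightarrow> real \<Rightarrow> real \<Rightarrow> real" where
  "metric_quotient G Z t s = crystalline_dist G (Z s) (Z t) / (s - t)"

text \<open>Meaningful only where the limit exists.\<close>

definition right_metric_derivative ::
    "(real^2) set \<Rightarrow> (real \<Rightarrow> (real^2)^'n) \<Rightarrow> real \<Rightarrow> real" where
  "right_metric_derivative G Z t = Lim (at_right t) (metric_quotient G Z t)"

definition metric_slope ::
    "(real^2) set \<Rightarrow> ((real^2)^'n \<Rightarrow> real) \<Rightarrow> (real^2)^'n \<Rightarrow> ereal" where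
  "metric_slope G E Z = Limsup (at Z) (\<lambda>X. ereal ((E Z - E X) / crystalline_dist G X Z))"

definition absolutely_continuous_curve :: "real set \<Rightarrow> (real \<Rightarrow> 'a::metric_space) \<Rightarrow> bool" where
  "absolutely_continuous_curve I f \<longleftrightarrow>
     (\<forall>\<epsilon>>0. \<exists>\<delta>>0. \<forall>(m::nat) a b.
        (\<forall>i<m. a i \<le> b i \<and> {a i..b i} \<subseteq> I) \<and>
        disjoint_family_on (\<lambda>i. {a i<..<b i}) {..<m} \<and>
        (\<Sum>i<m. b i - a i) < \<delta>
        \<longrightarrow> (\<Sum>i<m. dist (f (a i)) (f (b i))) < \<epsilon>)"

definition minimising_movement ::
    "(real^2) set \<Rightarrow> ((real^2)^'n \<Rightarrow> real) \<Rightarrow> (real^2)^'n \<Rightarrow> real \<Rightarrow> real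
      \<Rightarrow> (nat \<Rightarrow> (real^2)^'n) \<Rightarrow> bool" where
  "minimising_movement G E Z0 T \<tau> z \<longleftrightarrow>
     z 0 = Z0 \<and>
     (\<forall>k < nat \<lceil>T / \<tau>\<rceil>.
        is_arg_min (\<lambda>X. (glide_dist G (z k) X)\<^sup>2 / ereal (2 * \<tau>) + ereal (E X)) (\<lambda>_. True) (z (Suc k)))"

text \<open>The ceiling picks the unique \<open>k\<close> with \<open>t \<in> {(k - 1) * \<tau> <.. k * \<tau>}\<close>,
  see \<open>step_curve_eq\<close>.\<close>

definition step_curve :: "real \<Rightarrow> (nat \<Rightarrow> 'a) \<Rightarrow> real \<Rightarrow> 'a" where
  "step_curve \<tau> z t = z (nat \<lceil>t / \<tau>\<rceil>)"

lemma step_curve_eq: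
  assumes "\<tau> > 0" and "t \<in> {(real k - 1) * \<tau> <.. real k * \<tau>}"
  shows "step_curve \<tau> z t = z k"
proof -
  have "\<lceil>t / \<tau>\<rceil> = int k"
    using assms by (intro ceiling_unique) (auto simp: field_simps)
  then show ?thesis by (simp add: step_curve_def)
qed

end

theory Submission
  imports Defs "HOL-Complex_Analysis.Great_Picard"
begin

text \<open>
  The crystalline norm is the gauge of the convex hull of the glide directions. It is a genuine norm,
  it agrees with the Euclidean norm on the glide lines, and its dual norm is the maximum of
  \<open>p \<bullet> g\<close> over the glide directions \<open>g\<close>. The maximum is attained at a glide direction, that is,
  at a displacement for which the quasi-distance of the scheme and the crystalline distance coincide.
  This is why a scheme that may only move along glide lines dissipates energy at the rate prescribed
  by the metric slope of the crystalline distance.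

  The metric slope of \<open>E\<close> at \<open>X\<close> is the dual norm \<open>\<sigma>(X)\<close> of the gradient
  (\<open>metric_slope_eq_polar_size\<close>). Comparing a minimiser \<open>B\<close> that starts from \<open>A\<close> with the glide step
  \<open>A + \<tau> V\<close>, where \<open>V\<close> is the steepest descent vector along glide lines, gives
  \<open>E B - E A + |A - B|\<^sup>2 / (2 \<tau>) + \<tau> \<sigma>(A)\<^sup>2 / 2 \<le> o(\<tau>)\<close>
  (\<open>minimiser_dissipation\<close>). The uniform continuity of the gradient makes the error uniform in \<open>A\<close>. Since the gradient is bounded, steps have length at most \<open>2 M \<tau>\<close>, so the step
  curves are almost Lipschitz and a diagonal argument yields a pointwise convergent subsequence with
  a Lipschitz limit \<open>Y\<close>.

  Summing the one-step estimates between two times and passing to the limit gives the local inequality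
  \<open>E (Y t) - E (Y s) + N(Y t - Y s)\<^sup>2 / (2 (t - s)) + (t - s) \<sigma>(Y s)\<^sup>2 / 2 \<le> \<epsilon> (t - s)\<close> for
  \<open>t - s\<close> small, \<open>N\<close> being the crystalline norm on the product space (\<open>limit_dissipation\<close>). Dividing
  by \<open>t - s = h\<close>, integrating in \<open>s\<close> and letting \<open>h\<close> tend to zero proves the energy-dissipation
  inequality (\<open>integrated_dissipation\<close>): the energy differences telescope to boundary averages, and
  Fatou's lemma handles the difference quotients, because their right limits exist almost everywhere.
  The existence of these limits is a one-sided form of Rademacher's theorem on the line
  (\<open>Lipschitz_right_derivative_AE\<close>).
\<close>

section \<open>The crystalline norm and its dual\<close>

definition glide_lengths :: "(real^2) set \<Rightarrow> real^2 \<Rightarrow> real set" where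
  "glide_lengths G x =
     {a + b | a b. 0 \<le> a \<and> 0 \<le> b \<and> (\<exists>g\<in>G. \<exists>h\<in>G. x = a *\<^sub>R g + b *\<^sub>R h)}"

lemma crystalline_norm_glide_lengths: "crystalline_norm G x = Inf (glide_lengths G x)"
  by (simp add: crystalline_norm_def glide_lengths_def)

lemma glide_lengthsI:
  "\<lbrakk>0 \<le> a; 0 \<le> b; g \<in> G; h \<in> G; x = a *\<^sub>R g + b *\<^sub>R h\<rbrakk> \<Longrightarrow> a + b \<in> glide_lengths G x"
  by (auto simp: glide_lengths_def)

lemma glide_lengthsE:
  assumes "r \<in> glide_lengths G x"
  obtains a b g h where "0 \<le> a" "0 \<le> b" "g \<in> G" "h \<in> G" "x = a *\<^sub>R g + b *\<^sub>R h" "r = a + b"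
  using assms by (auto simp: glide_lengths_def)

text \<open>
  Three vectors of the plane are linearly dependent: the \<open>2 \<times> 2\<close> minors of the matrix with columns
  \<open>g, h, k\<close> give a relation, unless \<open>g\<close> and \<open>h\<close> are parallel and already related to each other.
  The sign of the sum of the coefficients is normalised so that subtracting a nonnegative multiple of the
  relation from a combination never increases the total weight.
\<close>

lemma plane_linear_relation:
  fixes g h k :: "real^2"
  assumes "g \<noteq> 0"
  obtains \<alpha> \<beta> \<gamma> :: real where "\<alpha> *\<^sub>R g + \<beta> *\<^sub>R h + \<gamma> *\<^sub>R k = 0"
    "\<alpha> \<noteq> 0 \<or> \<beta> \<noteq> 0 \<or> \<gamma> \<noteq> 0"  "0 \<le> \<alpha> + \<beta> + \<gamma>"
proof -
  have "\<exists>\<alpha> \<beta> \<gamma> :: real. \<alpha> *\<^sub>R g + \<beta> *\<^sub>R h + \<gamma> *\<^sub>R k = 0 \<and> (\<alpha> \<noteq> 0 \<or> \<beta> \<noteq> 0 \<or> \<gamma> \<noteq> 0)"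
  proof (cases "g$1 * h$2 = g$2 * h$1")
    case False
    have "(h$1 * k$2 - h$2 * k$1) *\<^sub>R g + (k$1 * g$2 - k$2 * g$1) *\<^sub>R h
        + (g$1 * h$2 - g$2 * h$1) *\<^sub>R k = 0"
      by (simp add: vec_eq_iff forall_2 algebra_simps)
    with False show ?thesis by (metis eq_iff_diff_eq_0)
  next
    case True
    have "(- (g \<bullet> h)) *\<^sub>R g + (g \<bullet> g) *\<^sub>R h + 0 *\<^sub>R k = 0"
      using True by (simp add: vec_eq_iff forall_2 inner_vec_def sum_2) algebra
    moreover have "g \<bullet> g \<noteq> 0" using assms by simp
    ultimately show ?thesis by blast
  qed
  then obtain \<alpha> \<beta> \<gamma> :: real where *: "\<alpha> *\<^sub>R g + \<beta> *\<^sub>R h + \<gamma> *\<^sub>R k = 0"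
    "\<alpha> \<noteq> 0 \<or> \<beta> \<noteq> 0 \<or> \<gamma> \<noteq> 0" by blast
  show ?thesis
  proof (cases "0 \<le> \<alpha> + \<beta> + \<gamma>")
    case True with * that show ?thesis by blast
  next
    case False
    have "(-\<alpha>) *\<^sub>R g + (-\<beta>) *\<^sub>R h + (-\<gamma>) *\<^sub>R k = - (\<alpha> *\<^sub>R g + \<beta> *\<^sub>R h + \<gamma> *\<^sub>R k)"
      by simp
    with * have "(-\<alpha>) *\<^sub>R g + (-\<beta>) *\<^sub>R h + (-\<gamma>) *\<^sub>R k = 0" by simp
    moreover have "0 \<le> -\<alpha> + -\<beta> + -\<gamma>" using False by simp
    ultimately show ?thesis using * that[of "-\<alpha>" "-\<beta>" "-\<gamma>"] by simp
  qed
qed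

text \<open>
  This is the conic form of Caratheodory's theorem in the plane, with control of the total weight:
  subtract the largest multiple \<open>t\<close> of a linear relation that keeps all three coefficients
  nonnegative. One coefficient becomes zero, and the total weight does not increase. It is the reason why
  combinations of only two directions suffice to define a norm.
\<close>

lemma three_glides_to_two:
  fixes g h k :: "real^2"
  assumes "g \<noteq> 0" "g \<in> G" "h \<in> G" "k \<in> G" "0 \<le> a" "0 \<le> b" "0 \<le> c"
  shows "\<exists>r\<in>glide_lengths G (a *\<^sub>R g + b *\<^sub>R h + c *\<^sub>R k). r \<le> a + b + c"
proof -
  obtain \<alpha> \<beta> \<gamma> where rel: "\<alpha> *\<^sub>R g + \<beta> *\<^sub>R h + \<gamma> *\<^sub>R k = 0"
    and nz: "\<alpha> \<noteq> 0 \<or> \<beta> \<noteq> 0 \<or> \<gamma> \<noteq> 0" and sum: "0 \<le> \<alpha> + \<beta> + \<gamma>"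
    using plane_linear_relation[OF \<open>g \<noteq> 0\<close>] by blast
  define S where "S = {p \<in> {(a,\<alpha>), (b,\<beta>), (c,\<gamma>)}. snd p > 0}"
  have "S \<noteq> {}"
  proof
    assume "S = {}"
    then have "\<alpha> \<le> 0" "\<beta> \<le> 0" "\<gamma> \<le> 0" by (auto simp: S_def not_less[symmetric])
    with nz sum show False by linarith
  qed
  moreover have "finite S" by (simp add: S_def)
  ultimately obtain p where p: "p \<in> S" "\<And>q. q \<in> S \<Longrightarrow> fst p / snd p \<le> fst q / snd q"
    using ex_min_if_finite[of "(\<lambda>q. fst q / snd q) ` S"] by (auto simp: not_less)
  \<comment> \<open>The ratio test: the first coefficient to reach zero is the one with the smallest quotient.\<close>
  define t where "t = fst p / snd p"
  have t0: "t \<ge> 0" using p(1) assms by (auto simp: t_def S_def)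
  have le: "0 \<le> x - t * y" if "(x,y) \<in> {(a,\<alpha>), (b,\<beta>), (c,\<gamma>)}" for x y
  proof (cases "y > 0")
    case True
    then have "(x,y) \<in> S" using that by (auto simp: S_def)
    then have "t \<le> x / y" using p(2) by (fastforce simp: t_def)
    with True show ?thesis by (simp add: field_simps)
  next
    case False
    then have "t * y \<le> 0" using t0 by (simp add: mult_le_0_iff)
    moreover have "x \<ge> 0" using that assms by auto
    ultimately show ?thesis by linarith
  qed
  have zero: "a - t * \<alpha> = 0 \<or> b - t * \<beta> = 0 \<or> c - t * \<gamma> = 0"
    using p(1) by (auto simp: S_def t_def)
  have "a *\<^sub>R g + b *\<^sub>R h + c *\<^sub>R k = a *\<^sub>R g + b *\<^sub>R h + c *\<^sub>R k - t *\<^sub>R (\<alpha> *\<^sub>R g + \<beta> *\<^sub>R h + \<gamma> *\<^sub>R k)"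
    by (simp add: rel)
  also have "\<dots> = (a - t * \<alpha>) *\<^sub>R g + (b - t * \<beta>) *\<^sub>R h + (c - t * \<gamma>) *\<^sub>R k"
    by (simp add: algebra_simps)
  finally have eq: "a *\<^sub>R g + b *\<^sub>R h + c *\<^sub>R k
      = (a - t * \<alpha>) *\<^sub>R g + (b - t * \<beta>) *\<^sub>R h + (c - t * \<gamma>) *\<^sub>R k" .
  have tot: "(a - t * \<alpha>) + (b - t * \<beta>) + (c - t * \<gamma>) \<le> a + b + c"
    using mult_nonneg_nonneg[OF t0 sum] by (simp add: algebra_simps)
  have pos: "0 \<le> a - t * \<alpha>" "0 \<le> b - t * \<beta>" "0 \<le> c - t * \<gamma>" using le by auto
  from zero show ?thesis
  proof (elim disjE)
    assume z: "a - t * \<alpha> = 0"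
    have "a *\<^sub>R g + b *\<^sub>R h + c *\<^sub>R k = (b - t * \<beta>) *\<^sub>R h + (c - t * \<gamma>) *\<^sub>R k"
      by (simp add: eq z)
    from glide_lengthsI[OF pos(2,3) assms(3,4) this] show ?thesis using tot z by fastforce
  next
    assume z: "b - t * \<beta> = 0"
    have "a *\<^sub>R g + b *\<^sub>R h + c *\<^sub>R k = (a - t * \<alpha>) *\<^sub>R g + (c - t * \<gamma>) *\<^sub>R k"
      by (simp add: eq z)
    from glide_lengthsI[OF pos(1,3) assms(2,4) this] show ?thesis using tot z by fastforce
  next
    assume z: "c - t * \<gamma> = 0"
    have "a *\<^sub>R g + b *\<^sub>R h + c *\<^sub>R k = (a - t * \<alpha>) *\<^sub>R g + (b - t * \<beta>) *\<^sub>R h"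
      by (simp add: eq z)
    from glide_lengthsI[OF pos(1,2) assms(2,3) this] show ?thesis using tot z by fastforce
  qed
qed

lemma glide_directions_memb:
  assumes "glide_directions G"
  shows "finite G" "\<And>g. g \<in> G \<Longrightarrow> norm g = 1" "\<And>g. g \<in> G \<Longrightarrow> g \<noteq> 0"
    "\<And>g. g \<in> G \<Longrightarrow> - g \<in> G" "G \<noteq> {}"
proof -
  show "finite G" "\<And>g. g \<in> G \<Longrightarrow> norm g = 1" "\<And>g. g \<in> G \<Longrightarrow> - g \<in> G"
    using assms by (auto simp: glide_directions_def)
  then show "\<And>g. g \<in> G \<Longrightarrow> g \<noteq> 0" by fastforce
  show "G \<noteq> {}"
  proof
    assume "G = {}"
    then have "(UNIV :: (real^2) set) = {0}" using assms by (simp add: glide_directions_def)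
    moreover have "(axis 1 1 :: real^2) \<noteq> 0" by (simp add: axis_eq_0_iff)
    ultimately show False by blast
  qed
qed

context
  fixes G :: "(real^2) set"
  assumes G: "glide_directions G"
begin

text \<open>
  Two reductions from three directions to two turn the four directions occurring in the
  representations of \<open>x\<close> and \<open>y\<close> into two.
\<close>

lemma glide_lengths_add:
  assumes "r \<in> glide_lengths G x" "s \<in> glide_lengths G y"
  shows "\<exists>t\<in>glide_lengths G (x + y). t \<le> r + s"
proof -
  obtain a b g h where 1: "0 \<le> a" "0 \<le> b" "g \<in> G" "h \<in> G" "x = a *\<^sub>R g + b *\<^sub>R h" "r = a + b"
    using assms(1) by (rule glide_lengthsE)
  obtain c d k l where 2: "0 \<le> c" "0 \<le> d" "k \<in> G" "l \<in> G" "y = c *\<^sub>R k + d *\<^sub>R l" "s = c + d"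
    using assms(2) by (rule glide_lengthsE)
  have "\<exists>t\<in>glide_lengths G (a *\<^sub>R g + b *\<^sub>R h + c *\<^sub>R k). t \<le> a + b + c"
    by (rule three_glides_to_two) (use 1 2 glide_directions_memb[OF G] in auto)
  then obtain t where t: "t \<in> glide_lengths G (a *\<^sub>R g + b *\<^sub>R h + c *\<^sub>R k)" "t \<le> a + b + c" by blast
  obtain a' b' g' h' where 3: "0 \<le> a'" "0 \<le> b'" "g' \<in> G" "h' \<in> G"
    "a *\<^sub>R g + b *\<^sub>R h + c *\<^sub>R k = a' *\<^sub>R g' + b' *\<^sub>R h'" "t = a' + b'"
    using t(1) by (rule glide_lengthsE)
  have "\<exists>t\<in>glide_lengths G (a' *\<^sub>R g' + b' *\<^sub>R h' + d *\<^sub>R l). t \<le> a' + b' + d"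
    by (rule three_glides_to_two) (use 2 3 glide_directions_memb[OF G] in auto)
  moreover have "a' *\<^sub>R g' + b' *\<^sub>R h' + d *\<^sub>R l = x + y"
    using 1(5) 2(5) 3(5) by (simp add: algebra_simps)
  ultimately obtain t' where "t' \<in> glide_lengths G (x + y)" "t' \<le> a' + b' + d" by auto
  moreover have "a' + b' + d \<le> r + s" using t(2) 1(6) 2(6) 3(6) by simp
  ultimately show ?thesis using order_trans by blast
qed

lemma glide_lengths_ge_norm: "r \<in> glide_lengths G x \<Longrightarrow> norm x \<le> r"
proof (erule glide_lengthsE)
  fix a b g h assume *: "0 \<le> a" "0 \<le> b" "g \<in> G" "h \<in> G" "x = a *\<^sub>R g + b *\<^sub>R h" "r = a + b"
  have "norm x \<le> norm (a *\<^sub>R g) + norm (b *\<^sub>R h)" using * norm_triangle_ineq by blast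
  then show "norm x \<le> r" using * glide_directions_memb(2)[OF G] by simp
qed

lemma glide_lengths_scale:
  assumes "r \<in> glide_lengths G x" "0 \<le> c"
  shows "c * r \<in> glide_lengths G (c *\<^sub>R x)"
proof -
  obtain a b g h where 1: "0 \<le> a" "0 \<le> b" "g \<in> G" "h \<in> G" "x = a *\<^sub>R g + b *\<^sub>R h" "r = a + b"
    using assms(1) by (rule glide_lengthsE)
  show ?thesis
    using glide_lengthsI[of "c * a" "c * b" g G h "c *\<^sub>R x"] 1 assms(2)
    by (simp add: algebra_simps)
qed

lemma glide_lengths_uminus:
  assumes "r \<in> glide_lengths G x"
  shows "r \<in> glide_lengths G (- x)"
proof -
  obtain a b g h where 1: "0 \<le> a" "0 \<le> b" "g \<in> G" "h \<in> G" "x = a *\<^sub>R g + b *\<^sub>R h" "r = a + b"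
    using assms by (rule glide_lengthsE)
  show ?thesis
    using glide_lengthsI[of a b "-g" G "-h" "- x"] 1 glide_directions_memb(4)[OF G] by simp
qed

lemma glide_lengths_glide:
  assumes "x \<in> glide_lines G"
  shows "norm x \<in> glide_lengths G x"
proof -
  obtain r g where rg: "x = r *\<^sub>R g" "g \<in> G" using assms by (auto simp: glide_lines_def)
  have "\<bar>r\<bar> + 0 \<in> glide_lengths G (\<bar>r\<bar> *\<^sub>R g)"
    by (rule glide_lengthsI) (use rg in auto)
  moreover have "x = \<bar>r\<bar> *\<^sub>R g \<or> x = - (\<bar>r\<bar> *\<^sub>R g)" using rg by (auto simp: abs_if)
  ultimately have "\<bar>r\<bar> \<in> glide_lengths G x" using glide_lengths_uminus by fastforce
  then show ?thesis using rg glide_directions_memb(2)[OF G] by simp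
qed

lemma glide_lengths_nonempty: "glide_lengths G x \<noteq> {}"
proof -
  have "x \<in> span G" using G by (simp add: glide_directions_def)
  then show ?thesis
  proof (induction rule: span_induct_alt)
    case base
    obtain g where "g \<in> G" using glide_directions_memb(5)[OF G] by auto
    then show ?case using glide_lengthsI[of 0 0 g G g 0] by auto
  next
    case (step c g y)
    have "norm (c *\<^sub>R g) \<in> glide_lengths G (c *\<^sub>R g)"
      by (rule glide_lengths_glide) (use step in \<open>auto simp: glide_lines_def\<close>)
    with step glide_lengths_add show ?case by blast
  qed
qed

lemma crystalline_norm_le: "r \<in> glide_lengths G x \<Longrightarrow> crystalline_norm G x \<le> r"
  unfolding crystalline_norm_glide_lengths
  by (rule cInf_lower) (auto intro: bdd_belowI glide_lengths_ge_norm)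

lemma norm_le_crystalline_norm: "norm x \<le> crystalline_norm G x"
  unfolding crystalline_norm_glide_lengths
  by (rule cInf_greatest) (auto simp: glide_lengths_nonempty glide_lengths_ge_norm)

lemma crystalline_norm_glide: "x \<in> glide_lines G \<Longrightarrow> crystalline_norm G x = norm x"
  using crystalline_norm_le glide_lengths_glide norm_le_crystalline_norm by (meson order_antisym)

lemma crystalline_norm_nonneg: "0 \<le> crystalline_norm G x"
  using norm_le_crystalline_norm norm_ge_zero order_trans by blast

lemma crystalline_norm_triangle:
  "crystalline_norm G (x + y) \<le> crystalline_norm G x + crystalline_norm G y"
proof -
  have 1: "crystalline_norm G (x + y) \<le> r + s"
    if "r \<in> glide_lengths G x" "s \<in> glide_lengths G y" for r s
    using glide_lengths_add[OF that] crystalline_norm_le order_trans by blast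
  have 2: "crystalline_norm G (x + y) - r \<le> crystalline_norm G y"
    if "r \<in> glide_lengths G x" for r
    unfolding crystalline_norm_glide_lengths[of G y]
    by (rule cInf_greatest) (use 1[OF that] in \<open>auto simp: glide_lengths_nonempty algebra_simps\<close>)
  have "crystalline_norm G (x + y) - crystalline_norm G y \<le> crystalline_norm G x"
    unfolding crystalline_norm_glide_lengths[of G x]
    by (rule cInf_greatest) (use 2 in \<open>auto simp: glide_lengths_nonempty algebra_simps\<close>)
  then show ?thesis by simp
qed

lemma crystalline_norm_scale:
  assumes "0 \<le> c"
  shows "crystalline_norm G (c *\<^sub>R x) = c * crystalline_norm G x"
proof (cases "c = 0")
  case True
  obtain g where "g \<in> G" using glide_directions_memb(5)[OF G] by auto
  then have "(0 :: real^2) \<in> glide_lines G" by (force simp: glide_lines_def)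
  then show ?thesis using crystalline_norm_glide True by simp
next
  case False
  with assms have c: "c > 0" by simp
  have le: "crystalline_norm G (d *\<^sub>R y) \<le> d * crystalline_norm G y" if d: "d > 0" for d y
  proof -
    have "crystalline_norm G (d *\<^sub>R y) / d \<le> crystalline_norm G y"
      unfolding crystalline_norm_glide_lengths[of G y]
    proof (rule cInf_greatest)
      fix r assume "r \<in> glide_lengths G y"
      then have "crystalline_norm G (d *\<^sub>R y) \<le> d * r"
        using d glide_lengths_scale crystalline_norm_le by simp
      then show "crystalline_norm G (d *\<^sub>R y) / d \<le> r" using d by (simp add: field_simps)
    qed (simp add: glide_lengths_nonempty)
    then show ?thesis using d by (simp add: field_simps)
  qed
  have "crystalline_norm G ((1/c) *\<^sub>R (c *\<^sub>R x)) \<le> (1/c) * crystalline_norm G (c *\<^sub>R x)"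
    by (rule le) (use c in simp)
  then have "c * crystalline_norm G x \<le> crystalline_norm G (c *\<^sub>R x)"
    using c by (simp add: field_simps)
  with le[OF c] show ?thesis by (meson order_antisym)
qed

text \<open>
  The triangle inequality and homogeneity make the norm convex, and a convex function on a
  finite-dimensional space is continuous.
\<close>

lemma continuous_crystalline_norm: "continuous_on UNIV (crystalline_norm G)"
proof (rule convex_on_continuous)
  show "convex_on UNIV (crystalline_norm G)"
  proof (rule convex_onI)
    fix t :: real and x y :: "real^2" assume "0 < t" "t < 1"
    then show "crystalline_norm G ((1 - t) *\<^sub>R x + t *\<^sub>R y)
        \<le> (1 - t) * crystalline_norm G x + t * crystalline_norm G y"
      using crystalline_norm_triangle[of "(1 - t) *\<^sub>R x" "t *\<^sub>R y"]
      by (simp add: crystalline_norm_scale)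
  qed simp
qed simp

end

definition crystalline_size :: "(real^2) set \<Rightarrow> (real^2)^'n \<Rightarrow> real" where
  "crystalline_size G X = L2_set (\<lambda>i. crystalline_norm G (X $ i)) UNIV"

lemma crystalline_dist_size: "crystalline_dist G X Y = crystalline_size G (X - Y)"
  by (simp add: crystalline_dist_def crystalline_size_def L2_set_def)

text \<open>
  The dual of the crystalline norm, that is, the support function of the convex hull of \<open>G\<close>.
\<close>

definition polar_norm :: "(real^2) set \<Rightarrow> real^2 \<Rightarrow> real" where
  "polar_norm G p = Max ((\<bullet>) p ` G)"

definition polar_size :: "(real^2) set \<Rightarrow> (real^2)^'n \<Rightarrow> real" where
  "polar_size G P = L2_set (\<lambda>i. polar_norm G (P $ i)) UNIV"

context
  fixes G :: "(real^2) set"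
  assumes G: "glide_directions G"
begin

lemma inner_le_polar_norm: "g \<in> G \<Longrightarrow> p \<bullet> g \<le> polar_norm G p"
  unfolding polar_norm_def by (rule Max_ge) (auto simp: glide_directions_memb[OF G])

lemma polar_norm_attained: "\<exists>g\<in>G. p \<bullet> g = polar_norm G p"
  using Max_in[of "(\<bullet>) p ` G"] glide_directions_memb[OF G] unfolding polar_norm_def by fastforce

lemma polar_norm_nonneg: "0 \<le> polar_norm G p"
proof -
  obtain g where g: "g \<in> G" using glide_directions_memb(5)[OF G] by auto
  have "p \<bullet> g \<le> polar_norm G p" "p \<bullet> (- g) \<le> polar_norm G p"
    using g glide_directions_memb(4)[OF G] by (blast intro: inner_le_polar_norm)+
  then show ?thesis by simp
qed

lemma polar_norm_uminus: "polar_norm G (- p) = polar_norm G p"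
proof -
  have le: "polar_norm G (- p) \<le> polar_norm G p" for p
    using polar_norm_attained[of "- p"] inner_le_polar_norm[of _ p] glide_directions_memb(4)[OF G]
    by (metis inner_minus_left inner_minus_right)
  show ?thesis using le[of p] le[of "- p"] by simp
qed

lemma polar_norm_le_add: "polar_norm G p \<le> polar_norm G q + norm (p - q)"
proof -
  obtain g where g: "g \<in> G" "p \<bullet> g = polar_norm G p" using polar_norm_attained by blast
  have "p \<bullet> g = q \<bullet> g + (p - q) \<bullet> g" by (simp add: algebra_simps)
  also have "\<dots> \<le> polar_norm G q + norm (p - q) * norm g"
    by (intro add_mono inner_le_polar_norm norm_cauchy_schwarz g)
  finally show ?thesis using g glide_directions_memb(2)[OF G] by simp
qed

lemma polar_norm_le_norm: "polar_norm G p \<le> norm p"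
proof -
  obtain g where g: "g \<in> G" "p \<bullet> g = polar_norm G p" using polar_norm_attained by blast
  then show ?thesis using norm_cauchy_schwarz[of p g] glide_directions_memb(2)[OF G] by simp
qed

text \<open>
  The duality inequality: it holds with \<open>p \<bullet> x\<close> expanded along any representation of \<open>x\<close> by
  two glide directions, hence for the infimum over all representations.
\<close>

lemma inner_le_polar_crystalline: "p \<bullet> x \<le> polar_norm G p * crystalline_norm G x"
proof -
  have "p \<bullet> x \<le> polar_norm G p * r" if r: "r \<in> glide_lengths G x" for r
  proof -
    obtain a b g h where 1: "0 \<le> a" "0 \<le> b" "g \<in> G" "h \<in> G" "x = a *\<^sub>R g + b *\<^sub>R h" "r = a + b"
      using r by (rule glide_lengthsE)
    have "p \<bullet> x = a * (p \<bullet> g) + b * (p \<bullet> h)" using 1 by (simp add: inner_add_right)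
    also have "\<dots> \<le> a * polar_norm G p + b * polar_norm G p"
      by (intro add_mono mult_left_mono inner_le_polar_norm 1)
    finally show ?thesis using 1 by (simp add: algebra_simps)
  qed
  note * = this
  show ?thesis
  proof (cases "polar_norm G p = 0")
    case True
    obtain r where "r \<in> glide_lengths G x" using glide_lengths_nonempty[OF G] by blast
    with *[of r] True show ?thesis by simp
  next
    case False
    with polar_norm_nonneg[of p] have pos: "polar_norm G p > 0" by simp
    have "p \<bullet> x / polar_norm G p \<le> crystalline_norm G x"
      unfolding crystalline_norm_glide_lengths
      by (rule cInf_greatest)
        (use * pos in \<open>auto simp: glide_lengths_nonempty[OF G] field_simps\<close>)
    then show ?thesis using pos by (simp add: field_simps)
  qed
qed

lemma crystalline_size_nonneg: "0 \<le> crystalline_size G X"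
  by (simp add: crystalline_size_def L2_set_nonneg)

lemma crystalline_size_triangle:
  "crystalline_size G (X + Y) \<le> crystalline_size G X + crystalline_size G Y"
proof -
  have "crystalline_size G (X + Y)
      \<le> L2_set (\<lambda>i. crystalline_norm G (X $ i) + crystalline_norm G (Y $ i)) UNIV"
    unfolding crystalline_size_def
    by (rule L2_set_mono) (auto simp: crystalline_norm_triangle[OF G] crystalline_norm_nonneg[OF G])
  also have "\<dots> \<le> crystalline_size G X + crystalline_size G Y"
    unfolding crystalline_size_def by (rule L2_set_triangle_ineq)
  finally show ?thesis .
qed

lemma crystalline_size_scale: "0 \<le> c \<Longrightarrow> crystalline_size G (c *\<^sub>R X) = c * crystalline_size G X"
  by (simp add: crystalline_size_def crystalline_norm_scale[OF G] L2_set_right_distrib)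

lemma norm_le_crystalline_size: "norm X \<le> crystalline_size G X"
  unfolding crystalline_size_def norm_vec_def[of X]
  by (rule L2_set_mono) (auto simp: norm_le_crystalline_norm[OF G])

lemma crystalline_size_glide:
  "(\<And>i. X $ i \<in> glide_lines G) \<Longrightarrow> crystalline_size G X = norm X"
  by (simp add: crystalline_size_def norm_vec_def crystalline_norm_glide[OF G])

lemma continuous_crystalline_size:
  "continuous_on UNIV (crystalline_size G :: (real^2)^'n \<Rightarrow> real)"
proof -
  have "continuous_on UNIV (\<lambda>X :: (real^2)^'n. crystalline_norm G (X $ i))" for i
    by (rule continuous_on_compose2[OF continuous_crystalline_norm[OF G]])
      (auto intro!: continuous_intros)
  then show ?thesis
    unfolding crystalline_size_def L2_set_def by (intro continuous_intros) auto
qed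

lemma polar_size_nonneg: "0 \<le> polar_size G P"
  by (simp add: polar_size_def L2_set_nonneg)

lemma polar_size_uminus: "polar_size G (- P) = polar_size G P"
  by (simp add: polar_size_def polar_norm_uminus)

lemma polar_size_le_add: "polar_size G P \<le> polar_size G Q + norm (P - Q)"
proof -
  have "polar_size G P \<le> L2_set (\<lambda>i. polar_norm G (Q $ i) + norm ((P - Q) $ i)) UNIV"
    unfolding polar_size_def
    by (rule L2_set_mono) (auto simp: polar_norm_nonneg polar_norm_le_add)
  also have "\<dots> \<le> polar_size G Q + norm (P - Q)"
    unfolding polar_size_def norm_vec_def[of "P - Q"] by (rule L2_set_triangle_ineq)
  finally show ?thesis .
qed

lemma abs_polar_size_diff_le: "\<bar>polar_size G P - polar_size G Q\<bar> \<le> norm (P - Q)"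
  using polar_size_le_add[of P Q] polar_size_le_add[of Q P] by (simp add: norm_minus_commute abs_le_iff)

lemma polar_size_le_norm: "polar_size G P \<le> norm P"
  unfolding polar_size_def norm_vec_def[of P]
  by (rule L2_set_mono) (auto simp: polar_norm_nonneg polar_norm_le_norm)

lemma continuous_polar_size: "continuous_on UNIV (polar_size G :: (real^2)^'n \<Rightarrow> real)"
proof (rule continuous_onI)
  fix P :: "(real^2)^'n" and e :: real assume "e > 0"
  then show "\<exists>d>0. \<forall>Q\<in>UNIV. dist Q P < d \<longrightarrow> dist (polar_size G Q) (polar_size G P) \<le> e"
    using abs_polar_size_diff_le[of _ P]
    by (intro exI[of _ e]) (auto simp: dist_norm intro: order_trans[OF _ less_imp_le])
qed

lemma inner_le_polar_crystalline_size: "P \<bullet> X \<le> polar_size G P * crystalline_size G X"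
proof -
  have "P \<bullet> X \<le> (\<Sum>i\<in>UNIV. polar_norm G (P $ i) * crystalline_norm G (X $ i))"
    unfolding inner_vec_def[of P X] by (rule sum_mono) (rule inner_le_polar_crystalline)
  also have "\<dots> = (\<Sum>i\<in>UNIV. \<bar>polar_norm G (P $ i)\<bar> * \<bar>crystalline_norm G (X $ i)\<bar>)"
    by (simp add: polar_norm_nonneg crystalline_norm_nonneg[OF G])
  also have "\<dots> \<le> polar_size G P * crystalline_size G X"
    unfolding polar_size_def crystalline_size_def by (rule L2_set_mult_ineq)
  finally show ?thesis .
qed

text \<open>
  The duality inequality is sharp, and it is sharp on displacements all of whose components lie on
  glide lines. This links the scheme, which only sees such displacements, to the crystalline metric.
\<close>

lemma optimal_glide_vector:
  fixes P :: "(real^2)^'n"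
  obtains V where "\<And>i. V $ i \<in> glide_lines G" "norm V = polar_size G P"
    "P \<bullet> V = (polar_size G P)\<^sup>2"
proof -
  have "\<forall>i. \<exists>g. g \<in> G \<and> P $ i \<bullet> g = polar_norm G (P $ i)" using polar_norm_attained by blast
  from choice[OF this] obtain g
    where g: "\<And>i. g i \<in> G" "\<And>i. P $ i \<bullet> g i = polar_norm G (P $ i)" by blast
  define V where "V = (\<chi> i. polar_norm G (P $ i) *\<^sub>R g i)"
  have "V $ i \<in> glide_lines G" for i using g by (auto simp: V_def glide_lines_def)
  moreover have "norm V = polar_size G P"
    using g glide_directions_memb(2)[OF G]
    unfolding norm_vec_def[of V] by (simp add: V_def polar_size_def polar_norm_nonneg)
  moreover have "P \<bullet> V = (polar_size G P)\<^sup>2"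
    unfolding inner_vec_def[of P V] using g
    by (simp add: V_def polar_size_def L2_set_def sum_nonneg power2_eq_square)
  ultimately show ?thesis by (rule that)
qed

end

section \<open>Right derivatives of Lipschitz functions\<close>

text \<open>
  A continuous induction from left to right: let \<open>s\<close> be the last point at which the growth bound
  holds. If \<open>s\<close> lies in \<open>K\<close>, steepness carries the bound past \<open>s\<close>; otherwise \<open>K\<close> misses a
  neighbourhood of \<open>s\<close> and monotonicity does. The steepness hypothesis holds wherever the upper
  right Dini derivative exceeds \<open>c\<close>.
\<close>

lemma steep_closed_set_growth:
  fixes F :: "real \<Rightarrow> real"
  assumes mono: "\<And>x y. x \<le> y \<Longrightarrow> F x \<le> F y" and c: "0 \<le> c" and K: "closed K"
    and steep: "\<And>x d. \<lbrakk>x \<in> K; 0 < d\<rbrakk> \<Longrightarrow> \<exists>h. 0 < h \<and> h < d \<and> c * h < F (x + h) - F x"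
    and ab: "a \<le> b"
  shows "c * measure lebesgue (K \<inter> {a..b}) \<le> F b - F a"
proof -
  define m where "m x y = measure lebesgue (K \<inter> {x..y})" for x y
  have Klm: "K \<inter> {x..y} \<in> lmeasurable" for x y
    by (intro lmeasurable_compact closed_Int_compact K) simp
  have m_le: "m x y \<le> y - x" if "x \<le> y" for x y
    using measure_mono_fmeasurable[of "K \<inter> {x..y}" "{x..y}" lebesgue] Klm that
    by (auto simp: m_def fmeasurableD)
  have m_add: "m x z \<le> m x y + m y z" if "x \<le> y" "y \<le> z" for x y z
  proof -
    have "m x z = measure lebesgue ((K \<inter> {x..y}) \<union> (K \<inter> {y..z}))"
      unfolding m_def by (rule arg_cong[of _ _ "measure lebesgue"]) (use that in auto)
    also have "\<dots> \<le> m x y + m y z"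
      unfolding m_def by (rule measure_Un_le) (auto intro: fmeasurableD Klm)
    finally show ?thesis .
  qed
  define S where "S = {x \<in> {a..b}. c * m a x \<le> F x - F a}"
  have aS: "a \<in> S" using ab m_le[of a a] by (auto simp: S_def mult_nonneg_nonpos[OF c])
  have bdd: "bdd_above S" by (auto simp: S_def bdd_above_def)
  define s where "s = Sup S"
  have sab: "a \<le> s" "s \<le> b"
    using aS bdd by (auto simp: s_def intro: cSup_upper cSup_least) (auto simp: S_def intro!: cSup_least)
  have "c * m a s \<le> F s - F a"
  proof (rule field_le_epsilon)
    fix e :: real assume e: "e > 0"
    obtain x where x: "x \<in> S" "s - e / (c + 1) < x"
      using less_cSupD[of S "s - e / (c + 1)"] aS e c unfolding s_def by (auto simp: field_simps)
    have xs: "x \<le> s" using x bdd by (auto simp: s_def intro: cSup_upper)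
    have "c * m a s \<le> c * (m a x + (s - x))"
      using m_add[of a x s] m_le[of x s] x xs c by (intro mult_left_mono) (auto simp: S_def)
    also have "\<dots> \<le> (F x - F a) + c * (s - x)" using x by (auto simp: S_def algebra_simps)
    also have "\<dots> \<le> (F s - F a) + c * (e / (c + 1))"
      using mono[OF xs] x(2) c by (intro add_mono mult_left_mono) auto
    also have "c * (e / (c + 1)) \<le> e" using c e by (simp add: field_simps)
    finally show "c * m a s \<le> F s - F a + e" by simp
  qed
  then have sS: "s \<in> S" using sab by (simp add: S_def)
  have "s = b"
  proof (rule ccontr)
    assume "s \<noteq> b"
    with sab have sb: "s < b" by simp
    have "\<exists>h. 0 < h \<and> h < b - s \<and> c * m s (s + h) \<le> F (s + h) - F s"
    proof (cases "s \<in> K")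
      case True
      obtain h where h: "0 < h" "h < b - s" "c * h < F (s + h) - F s"
        using steep[OF True, of "b - s"] sb by auto
      have "c * m s (s + h) \<le> c * h" using m_le[of s "s + h"] h c by (intro mult_left_mono) auto
      with h show ?thesis by (intro exI[of _ h]) linarith
    next
      case False
      then obtain e where e: "e > 0" "\<And>y. dist y s < e \<Longrightarrow> y \<notin> K"
        using K unfolding closed_def open_dist by blast
      define h where "h = min e (b - s) / 2"
      have h: "0 < h" "h < b - s" "h < e" using e sb by (auto simp: h_def min_def)
      have "K \<inter> {s..s + h} = {}" using e(2) h by (auto simp: dist_real_def)
      then have "m s (s + h) = 0" by (simp add: m_def)
      with h mono[of s "s + h"] show ?thesis by (intro exI[of _ h]) auto
    qed
    then obtain h where h: "0 < h" "h < b - s" "c * m s (s + h) \<le> F (s + h) - F s" by blast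
    have "c * m a (s + h) \<le> c * (m a s + m s (s + h))"
      using m_add[of a s "s + h"] sab h c by (intro mult_left_mono) auto
    then have "c * m a (s + h) \<le> F (s + h) - F a"
      using sS h(3) by (simp add: S_def algebra_simps)
    then have "s + h \<in> S" using sab h by (simp add: S_def)
    then have "s + h \<le> s" unfolding s_def using bdd by (rule cSup_upper)
    with h show False by simp
  qed
  with sS show ?thesis by (simp add: S_def m_def)
qed

text \<open>
  Inner regularity of the Lebesgue measure carries the bound from closed to measurable sets.
\<close>

lemma steep_set_growth:
  fixes F :: "real \<Rightarrow> real"
  assumes mono: "\<And>x y. x \<le> y \<Longrightarrow> F x \<le> F y" and c: "0 \<le> c" and A: "A \<in> sets lebesgue"
    and steep: "\<And>x d. \<lbrakk>x \<in> A; 0 < d\<rbrakk> \<Longrightarrow> \<exists>h. 0 < h \<and> h < d \<and> c * h < F (x + h) - F x"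
    and ab: "a \<le> b"
  shows "c * measure lebesgue (A \<inter> {a..b}) \<le> F b - F a"
proof (rule field_le_epsilon)
  fix e :: real assume e: "e > 0"
  define d where "d = e / (c + 1)"
  have d: "d > 0" using e c by (simp add: d_def)
  obtain K where K: "closed K" "K \<subseteq> A" "A - K \<in> lmeasurable" "emeasure lebesgue (A - K) < ennreal d"
    using sets_lebesgue_inner_closed[OF A d] by metis
  have mAK: "measure lebesgue (A - K) \<le> d"
    using K(4) d by (simp add: measure_def enn2real_leI less_imp_le)
  have Klm: "K \<inter> {a..b} \<in> lmeasurable"
    by (intro lmeasurable_compact closed_Int_compact K) simp
  have "measure lebesgue (A \<inter> {a..b}) \<le> measure lebesgue ((K \<inter> {a..b}) \<union> (A - K))"
    by (rule measure_mono_fmeasurable) (use A K Klm in auto)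
  also have "\<dots> \<le> measure lebesgue (K \<inter> {a..b}) + measure lebesgue (A - K)"
    using Klm K(3) by (intro measure_Un_le) auto
  finally have "c * measure lebesgue (A \<inter> {a..b}) \<le> c * (measure lebesgue (K \<inter> {a..b}) + d)"
    using mAK c by (intro mult_left_mono) auto
  also have "c * measure lebesgue (K \<inter> {a..b}) \<le> F b - F a"
    by (rule steep_closed_set_growth) (use mono c K steep ab in auto)
  then have "c * (measure lebesgue (K \<inter> {a..b}) + d) \<le> F b - F a + c * d"
    by (simp add: algebra_simps)
  also have "c * d \<le> e" using c e by (simp add: d_def field_simps)
  finally show "c * measure lebesgue (A \<inter> {a..b}) \<le> F b - F a + e" by simp
qed

text \<open>
  Cover a bounded part \<open>B\<close> of \<open>A\<close> by nonoverlapping intervals of total length at most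
  \<open>|B| + e\<close>. Since \<open>A\<close> fills at most the fraction \<open>r\<close> of each of them, \<open>|B| \<le> r (|B| + e)\<close>, and
  \<open>r < 1\<close> forces \<open>|B| = 0\<close>.
\<close>

lemma small_interval_density_imp_negligible:
  fixes A :: "real set"
  assumes A: "A \<in> sets lebesgue" and r: "0 \<le> r" "r < 1"
    and dens: "\<And>a b. a \<le> b \<Longrightarrow> measure lebesgue (A \<inter> {a..b}) \<le> r * (b - a)"
  shows "negligible A"
proof -
  have lm: "A \<inter> {a..b} \<in> lmeasurable" for a b
    using A by (metis bounded_set_imp_lmeasurable bounded_Int bounded_closed_interval sets.Int lmeasurable_interval(1) fmeasurableD interval_cbox)
  have "negligible (A \<inter> cbox a b)" for a b
  proof -
    define B where "B = A \<inter> cbox a b"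
    have B: "B \<in> lmeasurable" "B \<subseteq> cbox a b" using lm[of a b] by (auto simp: B_def)
    have "measure lebesgue B \<le> r * (measure lebesgue B + e)" if e: "e > 0" for e
    proof -
      obtain D where D: "countable D" "\<And>K. K \<in> D \<Longrightarrow> K \<subseteq> cbox a b \<and> K \<noteq> {} \<and> (\<exists>c d. K = cbox c d)"
        "pairwise (\<lambda>A B. interior A \<inter> interior B = {}) D"
        "B \<subseteq> \<Union>D" "\<Union>D \<in> lmeasurable" "measure lebesgue (\<Union>D) \<le> measure lebesgue B + e"
        using measurable_outer_intervals_bounded[OF B e] by metis
      have disj: "disjoint_family_on interior D"
        using D(3) by (auto simp: disjoint_family_on_def pairwise_def)
      have null: "(\<Union>K\<in>D. frontier K) \<in> null_sets lebesgue"
      proof (rule null_sets_UN'[OF D(1)])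
        fix K assume "K \<in> D"
        then obtain c d where "K = cbox c d" using D(2) by blast
        then show "frontier K \<in> null_sets lebesgue"
          using negligible_frontier_interval[of c d] negligible_convex_frontier[of K]
          by (simp add: negligible_iff_null_sets)
      qed
      \<comment> \<open>Pass to the interiors, which are disjoint; the discarded endpoints form a null set.\<close>
      have "emeasure lebesgue B \<le> emeasure lebesgue ((\<Union>K\<in>D. B \<inter> interior K) \<union> (\<Union>K\<in>D. frontier K))"
      proof (rule emeasure_mono)
        show "B \<subseteq> (\<Union>K\<in>D. B \<inter> interior K) \<union> (\<Union>K\<in>D. frontier K)"
        proof
          fix x assume x: "x \<in> B"
          then obtain K where K: "K \<in> D" "x \<in> K" using D(4) by blast
          then have "x \<in> interior K \<or> x \<in> frontier K"
            using closure_subset[of K] by (auto simp: frontier_def)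
          with x K show "x \<in> (\<Union>K\<in>D. B \<inter> interior K) \<union> (\<Union>K\<in>D. frontier K)" by blast
        qed
        show "(\<Union>K\<in>D. B \<inter> interior K) \<union> (\<Union>K\<in>D. frontier K) \<in> sets lebesgue"
          using D(1) B null by (intro sets.Un sets.countable_UN' null_setsD2[OF null]) auto
      qed
      also have "\<dots> = emeasure lebesgue (\<Union>K\<in>D. B \<inter> interior K)"
        using null D(1) B by (intro emeasure_Un_null_set sets.countable_UN') auto
      also have "\<dots> = (\<integral>\<^sup>+K. emeasure lebesgue (B \<inter> interior K) \<partial>count_space D)"
        using D(1) B disj by (intro emeasure_UN_countable) (auto simp: disjoint_family_on_def)
      also have "\<dots> \<le> (\<integral>\<^sup>+K. ennreal r * emeasure lebesgue (interior K) \<partial>count_space D)"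
      proof (rule nn_integral_mono)
        fix K assume "K \<in> space (count_space D)"
        then have KD: "K \<in> D" by simp
        obtain c d where K: "K = cbox c d" "K \<noteq> {}" using D(2)[OF KD] by blast
        then have cd: "c \<le> d" by auto
        have "emeasure lebesgue (B \<inter> interior K) \<le> emeasure lebesgue (A \<inter> {c..d})"
        proof (rule emeasure_mono)
          show "B \<inter> interior K \<subseteq> A \<inter> {c..d}"
            using interior_subset[of K] K(1) by (auto simp: B_def)
        qed (rule fmeasurableD[OF lm])
        also have "\<dots> \<le> ennreal (r * (d - c))"
          using dens[OF cd] lm by (simp add: emeasure_eq_measure2 ennreal_leI)
        also have "\<dots> = ennreal r * emeasure lebesgue (interior K)"
          using K cd r by (simp add: ennreal_mult interior_atLeastAtMost_real)
        finally show "emeasure lebesgue (B \<inter> interior K) \<le> ennreal r * emeasure lebesgue (interior K)" .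
      qed
      also have "\<dots> = ennreal r * (\<integral>\<^sup>+K. emeasure lebesgue (interior K) \<partial>count_space D)"
        by (rule nn_integral_cmult) simp
      also have "\<dots> = ennreal r * emeasure lebesgue (\<Union>K\<in>D. interior K)"
        using D(1) disj by (subst emeasure_UN_countable) auto
      also have "\<dots> \<le> ennreal r * emeasure lebesgue (\<Union>D)"
        using interior_subset D(5) by (intro mult_left_mono emeasure_mono) (auto dest: fmeasurableD)
      finally have "ennreal (measure lebesgue B) \<le> ennreal (r * measure lebesgue (\<Union>D))"
        using B(1) D(5) r by (simp add: emeasure_eq_measure2 ennreal_mult)
      then have "measure lebesgue B \<le> r * measure lebesgue (\<Union>D)"
        using r by (subst (asm) ennreal_le_iff) auto
      also have "\<dots> \<le> r * (measure lebesgue B + e)" using D(6) r by (intro mult_left_mono)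
      finally show ?thesis .
    qed
    then have "measure lebesgue B \<le> r * measure lebesgue B + e" if "e > 0" for e
      using that[of] r mult_right_mono[of r 1 e] by (smt (verit) distrib_left mult.left_neutral)
    then have "measure lebesgue B \<le> r * measure lebesgue B" by (rule field_le_epsilon)
    then have "(1 - r) * measure lebesgue B \<le> 0" by (simp add: algebra_simps)
    then have "measure lebesgue B = 0"
      using r by (simp add: mult_le_0_iff antisym)
    then show ?thesis using B(1) by (simp add: negligible_iff_measure B_def)
  qed
  then show ?thesis by (subst negligible_on_intervals) simp
qed

text \<open>
  On the bad set both \<open>f + L x\<close> and \<open>L x - f\<close> are steep, with slopes exceeding \<open>q + L\<close> and
  \<open>L - p\<close>. The sum of the two functions is \<open>2 L x\<close>, so the two growth bounds add up to
  \<open>(2 L + q - p) |A \<inter> [a, b]| \<le> 2 L (b - a)\<close>, and \<open>A\<close> has density less than one in every interval.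
\<close>

lemma oscillating_slopes_negligible:
  fixes f :: "real \<Rightarrow> real"
  assumes lip: "\<And>x y. \<bar>f x - f y\<bar> \<le> L * \<bar>x - y\<bar>" and pq: "p < q" and A: "A \<in> sets lebesgue"
    and up: "\<And>x d. \<lbrakk>x \<in> A; 0 < d\<rbrakk> \<Longrightarrow> \<exists>h. 0 < h \<and> h < d \<and> q * h < f (x + h) - f x"
    and down: "\<And>x d. \<lbrakk>x \<in> A; 0 < d\<rbrakk> \<Longrightarrow> \<exists>h. 0 < h \<and> h < d \<and> f (x + h) - f x < p * h"
  shows "negligible A"
proof (cases "A = {}")
  case False
  then obtain x where x: "x \<in> A" by blast
  have L0: "0 \<le> L" using lip[of 0 1] by simp
  obtain h where h: "0 < h" "q * h < f (x + h) - f x" using up[OF x, of 1] by auto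
  have "f (x + h) - f x \<le> L * h" using lip[of "x + h" x] h by (simp add: abs_le_iff)
  with h have "q * h < L * h" by linarith
  then have qL: "q < L" using h(1) by (metis mult_less_cancel_right_pos)
  obtain k where k: "0 < k" "f (x + k) - f x < p * k" using down[OF x, of 1] by auto
  with lip[of "x + k" x] have "- L * k < p * k" by (simp add: abs_le_iff)
  with k have pL: "- L < p" by (metis mult_less_cancel_right_pos)
  define r where "r = 2 * L / (2 * L + (q - p))"
  show ?thesis
  proof (rule small_interval_density_imp_negligible[OF A])
    show "0 \<le> r" "r < 1" using L0 pq by (auto simp: r_def field_simps)
    fix a b :: real assume ab: "a \<le> b"
    have 1: "(q + L) * measure lebesgue (A \<inter> {a..b}) \<le> (f b + L * b) - (f a + L * a)"
    proof (rule steep_set_growth[OF _ _ A _ ab, where F = "\<lambda>x. f x + L * x"])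
      show "f x + L * x \<le> f y + L * y" if "x \<le> y" for x y
        using lip[of x y] that by (simp add: abs_le_iff algebra_simps)
      show "\<exists>h>0. h < d \<and> (q + L) * h < f (x + h) + L * (x + h) - (f x + L * x)"
        if xd: "x \<in> A" "0 < d" for x d
        using up[OF xd] by (auto simp: algebra_simps)
    qed (use pL pq in simp)
    have 2: "(L - p) * measure lebesgue (A \<inter> {a..b}) \<le> (L * b - f b) - (L * a - f a)"
    proof (rule steep_set_growth[OF _ _ A _ ab, where F = "\<lambda>x. L * x - f x"])
      show "L * x - f x \<le> L * y - f y" if "x \<le> y" for x y
        using lip[of x y] that by (simp add: abs_le_iff algebra_simps)
      show "\<exists>h>0. h < d \<and> (L - p) * h < L * (x + h) - f (x + h) - (L * x - f x)"
        if xd: "x \<in> A" "0 < d" for x d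
        using down[OF xd] by (auto simp: algebra_simps)
    qed (use qL pq in simp)
    have "(2 * L + (q - p)) * measure lebesgue (A \<inter> {a..b}) \<le> 2 * L * (b - a)"
      using 1 2 by (simp add: algebra_simps)
    moreover have "0 < 2 * L + (q - p)" using L0 pq by simp
    ultimately show "measure lebesgue (A \<inter> {a..b}) \<le> r * (b - a)"
      by (simp add: r_def field_simps)
  qed
qed simp

lemma Rats_in_open_real:
  fixes U :: "real set"
  assumes "open U" "x \<in> U"
  shows "\<exists>h\<in>U. h \<in> \<rat>"
proof -
  obtain e where e: "e > 0" "\<And>y. dist y x < e \<Longrightarrow> y \<in> U" using assms open_dist by metis
  obtain h where "h \<in> \<rat>" "x < h" "h < x + e" using Rats_dense_in_real[of x "x + e"] e by auto
  with e(2)[of h] show ?thesis by (auto simp: dist_real_def)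
qed

text \<open>
  At a point without a right derivative the lower and upper right Dini derivatives are separated by
  two rational numbers \<open>p < q\<close>, so the point belongs to one of countably many sets of oscillating slopes.
  By continuity of \<open>f\<close> it is enough to test rational increments, which makes these sets Borel.
\<close>

proposition Lipschitz_right_derivative_AE:
  fixes f :: "real \<Rightarrow> real"
  assumes lip: "\<And>x y. \<bar>f x - f y\<bar> \<le> L * \<bar>x - y\<bar>"
  shows "AE x in lebesgue. \<exists>l. ((\<lambda>h. (f (x + h) - f x) / h) \<longlongrightarrow> l) (at_right 0)"
proof -
  have L0: "0 \<le> L" using lip[of 0 1] by simp
  have cont: "continuous_on UNIV f"
    by (rule lipschitz_on_continuous_on[of L], rule lipschitz_onI) (use lip L0 in \<open>auto simp: dist_real_def\<close>)
  have cont_sh: "continuous_on UNIV (\<lambda>x. f (x + h))" "continuous_on UNIV (\<lambda>h. f (x + h))" for h x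
    by (rule continuous_on_compose2[OF cont]; auto intro!: continuous_intros)+
  define H where "H n = \<rat> \<inter> {0<..<1 / real (Suc n)}" for n
  define A where "A p q = (\<Inter>n. \<Union>h\<in>H n. {x. q * h < f (x + h) - f x})
      \<inter> (\<Inter>n. \<Union>h\<in>H n. {x. f (x + h) - f x < p * h})" for p q
  have H: "countable (H n)" for n by (auto simp: H_def intro: countable_subset[OF _ countable_rat])
  have A: "A p q \<in> sets lebesgue" for p q
  proof -
    have "A p q \<in> sets borel"
      unfolding A_def
      by (intro sets.Int sets.countable_INT' sets.countable_UN' H)
        (auto intro!: borel_open open_Collect_less continuous_intros cont_sh cont H)
    then show ?thesis by simp
  qed
  have neg: "negligible (A p q)" if "p < q" for p q
  proof (rule oscillating_slopes_negligible[OF lip that A])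
    fix x d :: real assume x: "x \<in> A p q" and d: "0 < d"
    obtain n where n: "1 / real (Suc n) < d" using d by (metis nat_approx_posE)
    from x obtain h where "h \<in> H n" "q * h < f (x + h) - f x" by (auto simp: A_def)
    then show "\<exists>h>0. h < d \<and> q * h < f (x + h) - f x" using n by (intro exI[of _ h]) (auto simp: H_def)
    from x obtain h where "h \<in> H n" "f (x + h) - f x < p * h" by (auto simp: A_def)
    then show "\<exists>h>0. h < d \<and> f (x + h) - f x < p * h" using n by (intro exI[of _ h]) (auto simp: H_def)
  qed
  define N where "N = (\<Union>(p,q)\<in>{(p,q). p \<in> \<rat> \<and> q \<in> \<rat> \<and> p < q}. A p q)"
  have "negligible N"
    unfolding N_def
  proof (rule negligible_countable_Union)
    have "countable {(p,q). p \<in> \<rat> \<and> q \<in> \<rat> \<and> p < (q::real)}"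
      by (rule countable_subset[of _ "\<rat> \<times> \<rat>"]) (auto intro: countable_rat)
    then show "countable ((\<lambda>(p, q). A p q) ` {(p, q). p \<in> \<rat> \<and> q \<in> \<rat> \<and> p < q})" by blast
  qed (auto intro: neg)
  moreover have "\<exists>l. ((\<lambda>h. (f (x + h) - f x) / h) \<longlongrightarrow> l) (at_right 0)" if x: "x \<notin> N" for x
  proof -
    define Q where "Q h = (f (x + h) - f x) / h" for h
    have bd: "\<bar>Q h\<bar> \<le> L" if "h > 0" for h
      using lip[of "x + h" x] that by (simp add: Q_def field_simps)
    let ?F = "at_right (0::real)"
    define l where "l = Liminf ?F (\<lambda>h. ereal (Q h))"
    define u where "u = Limsup ?F (\<lambda>h. ereal (Q h))"
    have ev: "eventually P ?F" if "\<And>h. 0 < h \<Longrightarrow> P h" for P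
      using that by (auto simp: eventually_at_right_field intro: exI[of _ 1])
    have "l \<le> u" unfolding l_def u_def by (rule Liminf_le_Limsup) simp
    \<comment> \<open>Failure of an eventual statement yields an increment, and openness moves it to a rational one.\<close>
    have near: "\<exists>h\<in>H n. P h" if "\<not> eventually (\<lambda>h. \<not> P h) ?F" "open {h. P h}" for P n
    proof -
      have "\<not> (\<forall>y>0. y < 1 / real (Suc n) \<longrightarrow> \<not> P y)"
      proof
        assume "\<forall>y>0. y < 1 / real (Suc n) \<longrightarrow> \<not> P y"
        then have "eventually (\<lambda>h. \<not> P h) ?F"
          unfolding eventually_at_right_field by (intro exI[of _ "1 / real (Suc n)"]) auto
        with that(1) show False ..
      qed
      then obtain h where h: "0 < h" "h < 1 / real (Suc n)" "P h" by blast
      have "open ({0<..<1 / real (Suc n)} \<inter> {h. P h})" using that(2) by (intro open_Int) auto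
      from Rats_in_open_real[OF this, of h] h show ?thesis by (auto simp: H_def)
    qed
    have "l = u"
    proof (rule ccontr)
      assume "l \<noteq> u"
      with \<open>l \<le> u\<close> have "l < u" by simp
      then obtain c where c: "l < ereal c" "ereal c < u" using ereal_dense2 by blast
      obtain p' where p': "l < ereal p'" "ereal p' < ereal c" using ereal_dense2[OF c(1)] by blast
      obtain q' where q': "ereal c < ereal q'" "ereal q' < u" using ereal_dense2[OF c(2)] by blast
      obtain p where p: "p \<in> \<rat>" "p' < p" "p < c" using Rats_dense_in_real[of p' c] p' by auto
      obtain q where q: "q \<in> \<rat>" "c < q" "q < q'" using Rats_dense_in_real[of c q'] q' by auto
      have lp: "l < ereal p" using p p' by (intro less_trans[OF p'(1)]) simp
      have qu: "ereal q < u" using q q' by (intro less_trans[OF _ q'(2)]) simp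
      have 1: "\<not> eventually (\<lambda>h. \<not> f (x + h) - f x < p * h) ?F"
      proof
        assume "eventually (\<lambda>h. \<not> f (x + h) - f x < p * h) ?F"
        moreover have "eventually (\<lambda>h. 0 < h) ?F" by (rule ev)
        ultimately have "eventually (\<lambda>h. ereal p \<le> ereal (Q h)) ?F"
          by eventually_elim (simp add: Q_def field_simps)
        then have "ereal p \<le> l" unfolding l_def by (rule Liminf_bounded)
        with lp show False by simp
      qed
      have 2: "\<not> eventually (\<lambda>h. \<not> q * h < f (x + h) - f x) ?F"
      proof
        assume "eventually (\<lambda>h. \<not> q * h < f (x + h) - f x) ?F"
        moreover have "eventually (\<lambda>h. 0 < h) ?F" by (rule ev)
        ultimately have "eventually (\<lambda>h. ereal (Q h) \<le> ereal q) ?F"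
          by eventually_elim (simp add: Q_def field_simps)
        then have "u \<le> ereal q" unfolding u_def by (rule Limsup_bounded)
        with qu show False by simp
      qed
      have "open {h. f (x + h) - f x < p * h}" "open {h. q * h < f (x + h) - f x}"
        by (auto intro!: open_Collect_less continuous_intros cont_sh)
      then have "x \<in> A p q"
        using near[OF 1] near[OF 2] by (auto simp: A_def)
      then have "x \<in> N" using p q unfolding N_def by (intro UN_I[of "(p,q)"]) auto
      with x show False by simp
    qed
    have "ereal (- L) \<le> l" unfolding l_def
      by (rule Liminf_bounded, rule ev) (use bd in \<open>force simp: abs_le_iff\<close>)
    moreover have "u \<le> ereal L" unfolding u_def
      by (rule Limsup_bounded, rule ev) (use bd in \<open>auto simp: abs_le_iff\<close>)
    ultimately obtain r where r: "u = ereal r" using \<open>l = u\<close> by (cases u) auto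
    have "((\<lambda>h. ereal (Q h)) \<longlongrightarrow> u) ?F"
      by (rule Liminf_eq_Limsup) (use \<open>l = u\<close> in \<open>auto simp: l_def u_def\<close>)
    then have "(Q \<longlongrightarrow> r) ?F" by (simp add: r)
    then show ?thesis unfolding Q_def by blast
  qed
  ultimately show ?thesis
    unfolding negligible_iff_null_sets eventually_ae_filter by (intro bexI[of _ N]) auto
qed

section \<open>The metric slope\<close>

lemma glide_linesI: "g \<in> G \<Longrightarrow> r *\<^sub>R g \<in> glide_lines G"
  unfolding glide_lines_def by blast

lemma zero_in_glide_lines: "glide_directions G \<Longrightarrow> 0 \<in> glide_lines G"
  using glide_linesI[of _ G 0] glide_directions_memb(5)[of G] by auto

lemma glide_lines_scaleR: "x \<in> glide_lines G \<Longrightarrow> c *\<^sub>R x \<in> glide_lines G"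
proof -
  assume "x \<in> glide_lines G"
  then obtain r g where "x = r *\<^sub>R g" "g \<in> G" by (auto simp: glide_lines_def)
  then show ?thesis using glide_linesI[of g G "c * r"] by simp
qed

lemma glide_lines_uminus: "- x \<in> glide_lines G \<longleftrightarrow> x \<in> glide_lines G"
  using glide_lines_scaleR[of x G "-1"] glide_lines_scaleR[of "-x" G "-1"] by auto

lemma GDERIV_first_order:
  assumes "GDERIV E X :> P" "0 < e"
  obtains d where "0 < d" "\<And>Y. norm (Y - X) < d \<Longrightarrow> \<bar>E Y - E X - P \<bullet> (Y - X)\<bar> \<le> e * norm (Y - X)"
proof -
  have "\<exists>d>0. \<forall>Y. norm (Y - X) < d \<longrightarrow> norm (E Y - E X - (Y - X) \<bullet> P) \<le> e * norm (Y - X)"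
    using assms unfolding gderiv_def has_derivative_at_alt by blast
  then show ?thesis using that by (auto simp: inner_commute)
qed

context
  fixes G :: "(real^2) set"
  assumes G: "glide_directions G"
begin

text \<open>
  The sharpness of the duality inequality, normalised for use as a direction of a difference quotient.
  If the dual norm of \<open>P\<close> vanishes, then \<open>P\<close> annihilates every direction and any unit glide
  vector will do.
\<close>

lemma optimal_unit_glide_vector:
  fixes P :: "(real^2)^'n"
  obtains W where "\<And>i. W $ i \<in> glide_lines G" "norm W = 1" "P \<bullet> W = polar_size G P"
proof (cases "polar_size G P = 0")
  case True
  obtain g where g: "g \<in> G" using glide_directions_memb(5)[OF G] by blast
  define W where "W = (axis undefined g :: (real^2)^'n)"
  have line: "W $ i \<in> glide_lines G" for i
  proof -
    have "W $ i = 1 *\<^sub>R g \<or> W $ i = 0 *\<^sub>R g" by (simp add: W_def axis_def)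
    with glide_linesI[OF g] show ?thesis by metis
  qed
  moreover have "norm W = 1" using g glide_directions_memb(2)[OF G] by (simp add: W_def norm_eq_1 inner_axis_axis)
  moreover have "P \<bullet> W \<le> 0" "P \<bullet> (- W) \<le> 0"
    using inner_le_polar_crystalline_size[OF G, of P W]
      inner_le_polar_crystalline_size[OF G, of P "- W"] True by simp_all
  ultimately show ?thesis using that[of W] True by simp
next
  case False
  with polar_size_nonneg[OF G, of P] have pos: "polar_size G P > 0" by simp
  obtain V where V: "\<And>i. V $ i \<in> glide_lines G" "norm V = polar_size G P"
    "P \<bullet> V = (polar_size G P)\<^sup>2" using optimal_glide_vector[OF G] by blast
  show ?thesis
    by (rule that[of "(1 / polar_size G P) *\<^sub>R V"])
      (use V pos in \<open>auto simp: glide_lines_scaleR power2_eq_square\<close>)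
qed

text \<open>
  The upper bound is the first-order expansion combined with the duality inequality; the error
  \<open>e |Y - X|\<close> is harmless because the crystalline norm dominates the Euclidean one. The lower bound
  approaches \<open>X\<close> along an optimal glide direction for \<open>- P\<close>, on which both norms agree.
\<close>

proposition metric_slope_eq_polar_size:
  fixes E :: "(real^2)^'n \<Rightarrow> real"
  assumes E: "GDERIV E X :> P"
  shows "metric_slope G E X = ereal (polar_size G P)"
proof (rule antisym)
  let ?q = "\<lambda>Y. (E X - E Y) / crystalline_dist G Y X"
  show "metric_slope G E X \<le> ereal (polar_size G P)"
  proof (rule ereal_le_epsilon2)
    fix e :: real assume e: "0 < e"
    obtain d where d: "0 < d"
      "\<And>Y. norm (Y - X) < d \<Longrightarrow> \<bar>E Y - E X - P \<bullet> (Y - X)\<bar> \<le> e * norm (Y - X)"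
      using GDERIV_first_order[OF E e] by blast
    have "?q Y \<le> polar_size G P + e" if Y: "Y \<noteq> X" "norm (Y - X) < d" for Y
    proof -
      have n: "0 < norm (Y - X)" "norm (Y - X) \<le> crystalline_size G (Y - X)"
        using Y norm_le_crystalline_size[OF G] by auto
      have "E X - E Y \<le> (- P) \<bullet> (Y - X) + e * norm (Y - X)"
        using d(2)[OF Y(2)] by (simp add: abs_le_iff)
      also have "\<dots> \<le> polar_size G (- P) * crystalline_size G (Y - X) + e * crystalline_size G (Y - X)"
        by (intro add_mono inner_le_polar_crystalline_size[OF G] mult_left_mono n) (use e in auto)
      also have "\<dots> = (polar_size G P + e) * crystalline_size G (Y - X)"
        by (simp add: polar_size_uminus[OF G] algebra_simps)
      finally show ?thesis using less_le_trans[OF n] by (simp add: crystalline_dist_size divide_le_eq)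
    qed
    then have "eventually (\<lambda>Y. ereal (?q Y) \<le> ereal (polar_size G P + e)) (at X)"
      unfolding eventually_at using d(1) by (auto simp: dist_norm)
    then show "metric_slope G E X \<le> ereal (polar_size G P) + ereal e"
      unfolding metric_slope_def by (auto intro: Limsup_bounded)
  qed
  show "ereal (polar_size G P) \<le> metric_slope G E X"
  proof (rule ereal_le_epsilon2)
    fix e :: real assume e: "0 < e"
    have "ereal (polar_size G P - e) \<le> metric_slope G E X"
    proof (rule ccontr)
      assume "\<not> ?thesis"
      then have "Limsup (at X) (\<lambda>Y. ereal (?q Y)) < ereal (polar_size G P - e)"
        by (simp add: metric_slope_def)
      then have "eventually (\<lambda>Y. ereal (?q Y) < ereal (polar_size G P - e)) (at X)"
        by (rule Limsup_lessD)
      then obtain r where r: "0 < r" "\<And>Y. \<lbrakk>Y \<noteq> X; norm (Y - X) < r\<rbrakk> \<Longrightarrow> ?q Y < polar_size G P - e"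
        unfolding eventually_at by (auto simp: dist_norm)
      obtain d where d: "0 < d"
        "\<And>Y. norm (Y - X) < d \<Longrightarrow> \<bar>E Y - E X - P \<bullet> (Y - X)\<bar> \<le> e * norm (Y - X)"
        using GDERIV_first_order[OF E e] by blast
      obtain W where W: "\<And>i. W $ i \<in> glide_lines G" "norm W = 1" "(- P) \<bullet> W = polar_size G (- P)"
        using optimal_unit_glide_vector by blast
      define h where "h = min r d / 2"
      have h: "0 < h" "h < r" "h < d" using r(1) d(1) by (auto simp: h_def min_def)
      have "W \<noteq> 0" using W(2) by auto
      have size: "crystalline_size G (h *\<^sub>R W) = h"
        using crystalline_size_glide[OF G, of "h *\<^sub>R W"] W h by (simp add: glide_lines_scaleR)
      have "?q (X + h *\<^sub>R W) < polar_size G P - e"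
        by (rule r(2)) (use W h \<open>W \<noteq> 0\<close> in auto)
      then have "E X - E (X + h *\<^sub>R W) < (polar_size G P - e) * h"
        using h by (simp add: crystalline_dist_size size divide_less_eq)
      moreover have "\<bar>E (X + h *\<^sub>R W) - E X - h * (P \<bullet> W)\<bar> \<le> e * h"
        using d(2)[of "X + h *\<^sub>R W"] W h by simp
      moreover have "P \<bullet> W = - polar_size G P" using W(3) by (simp add: polar_size_uminus[OF G])
      ultimately show False by (simp add: abs_le_iff algebra_simps)
    qed
    then show "ereal (polar_size G P) \<le> metric_slope G E X + ereal e"
      by (cases "metric_slope G E X") auto
  qed
qed

end

section \<open>One step of the scheme\<close>

lemma glide_dist_eq:
  "glide_dist G X Y = (if \<forall>i. (X - Y) $ i \<in> glide_lines G then ereal (norm (X - Y)) else \<infinity>)"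
proof -
  have "(\<forall>i. glide_dist1 G (X $ i) (Y $ i) \<noteq> \<infinity>) \<longleftrightarrow> (\<forall>i. (X - Y) $ i \<in> glide_lines G)"
    by (auto simp: glide_dist1_def)
  moreover have "sqrt (\<Sum>i\<in>UNIV. (real_of_ereal (glide_dist1 G (X $ i) (Y $ i)))\<^sup>2) = norm (X - Y)"
    if "\<forall>i. (X - Y) $ i \<in> glide_lines G"
    using that unfolding norm_vec_def[of "X - Y"] L2_set_def by (simp add: glide_dist1_def)
  ultimately show ?thesis by (auto simp: glide_dist_def)
qed

text \<open>
  Comparing with the admissible competitor \<open>A\<close> shows that the minimal value is finite, so a minimiser
  can be reached from \<open>A\<close> by glides and the functional is an ordinary real expression there.
\<close>

lemma glide_minimiser:
  assumes min: "is_arg_min (\<lambda>X. (glide_dist G A X)\<^sup>2 / ereal (2 * \<tau>) + ereal (E X)) (\<lambda>_. True) B"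
    and \<tau>: "0 < \<tau>" and G: "glide_directions G"
  shows glide_minimiser_lines: "\<And>i. (A - B) $ i \<in> glide_lines G"
    and glide_minimiser_le: "\<And>X. (\<And>i. (A - X) $ i \<in> glide_lines G)
      \<Longrightarrow> (norm (A - B))\<^sup>2 / (2 * \<tau>) + E B \<le> (norm (A - X))\<^sup>2 / (2 * \<tau>) + E X"
proof -
  define J where "J X = (glide_dist G A X)\<^sup>2 / ereal (2 * \<tau>) + ereal (E X)" for X
  have le: "J B \<le> J X" for X
    using min by (auto simp: is_arg_min_def J_def not_less)
  have fin: "J X = ereal ((norm (A - X))\<^sup>2 / (2 * \<tau>) + E X)"
    if "\<And>i. (A - X) $ i \<in> glide_lines G" for X
    using that \<tau> by (simp add: J_def glide_dist_eq)
  have "J A = ereal (E A)" using fin[of A] zero_in_glide_lines[OF G] by simp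
  with le[of A] have "J B \<noteq> \<infinity>" by auto
  then show lines: "\<And>i. (A - B) $ i \<in> glide_lines G"
    using \<tau> by (auto simp: J_def glide_dist_eq power2_eq_square split: if_splits)
  show "(norm (A - B))\<^sup>2 / (2 * \<tau>) + E B \<le> (norm (A - X))\<^sup>2 / (2 * \<tau>) + E X"
    if "\<And>i. (A - X) $ i \<in> glide_lines G" for X
    using le[of X] fin[OF that] fin[OF lines] by simp
qed

lemma GDERIV_mvt:
  assumes "\<And>X. GDERIV E X :> gradE X"
  obtains s where "0 < s" "s < 1" "E Y - E X = (Y - X) \<bullet> gradE (X + s *\<^sub>R (Y - X))"
proof -
  have "((\<lambda>s. E (X + s *\<^sub>R (Y - X))) has_derivative
      (\<lambda>h. (h *\<^sub>R (Y - X)) \<bullet> gradE (X + s *\<^sub>R (Y - X)))) (at s within {0..1})" for s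
  proof -
    have "(E has_derivative (\<lambda>h. h \<bullet> gradE (X + s *\<^sub>R (Y - X)))) (at (X + s *\<^sub>R (Y - X)))"
      using assms by (simp add: gderiv_def)
    moreover have "((\<lambda>s. X + s *\<^sub>R (Y - X)) has_derivative (\<lambda>h. h *\<^sub>R (Y - X))) (at s within {0..1})"
      by (auto intro!: derivative_eq_intros)
    ultimately show ?thesis by (rule has_derivative_compose[rotated])
  qed
  from mvt_simple[of 0 1 "\<lambda>s. E (X + s *\<^sub>R (Y - X))", OF _ this] show ?thesis
    by (auto intro: that)
qed

lemma GDERIV_bounded_Lipschitz:
  assumes E: "\<And>X. GDERIV E X :> gradE X" and M: "\<And>X. norm (gradE X) \<le> M"
  shows "\<bar>E X - E Y\<bar> \<le> M * norm (X - Y)"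
proof -
  obtain s where "E X - E Y = (X - Y) \<bullet> gradE (Y + s *\<^sub>R (X - Y))" by (rule GDERIV_mvt[OF E])
  then have "\<bar>E X - E Y\<bar> \<le> norm (X - Y) * norm (gradE (Y + s *\<^sub>R (X - Y)))"
    using Cauchy_Schwarz_ineq2 by metis
  also have "\<dots> \<le> norm (X - Y) * M" by (intro mult_left_mono M) simp
  finally show ?thesis by (simp add: mult.commute)
qed

text \<open>
  The bound \<open>M\<close> on the gradient is a Lipschitz constant of the energy, and through it controls
  the length of a step of the scheme.
\<close>

locale bounded_gradient_energy =
  fixes G :: "(real^2) set" and E :: "(real^2)^'n \<Rightarrow> real" and gradE :: "(real^2)^'n \<Rightarrow> (real^2)^'n"
    and M :: real
  assumes G: "glide_directions G" and E: "\<And>X. GDERIV E X :> gradE X"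
    and M: "\<And>X. norm (gradE X) \<le> M"
begin

lemma M_nonneg: "0 \<le> M"
  using M norm_ge_zero order_trans by blast

lemma E_Lipschitz: "\<bar>E X - E Y\<bar> \<le> M * norm (X - Y)"
  using GDERIV_bounded_Lipschitz[OF E M] .

text \<open>
  The competitor \<open>A\<close> gives \<open>|A - B|\<^sup>2 / (2 \<tau>) \<le> E A - E B \<le> M |A - B|\<close>.
\<close>

lemma minimiser_step_length:
  assumes min: "is_arg_min (\<lambda>X. (glide_dist G A X)\<^sup>2 / ereal (2 * \<tau>) + ereal (E X)) (\<lambda>_. True) B"
    and \<tau>: "0 < \<tau>"
  shows "norm (A - B) \<le> 2 * M * \<tau>"
proof (cases "A = B")
  case True with M_nonneg \<tau> show ?thesis by simp
next
  case False
  then have pos: "0 < norm (A - B)" by simp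
  have "(norm (A - B))\<^sup>2 / (2 * \<tau>) + E B \<le> E A"
    using glide_minimiser_le[OF min \<tau> G, of A] zero_in_glide_lines[OF G] by simp
  then have "(norm (A - B))\<^sup>2 / (2 * \<tau>) \<le> M * norm (A - B)"
    using E_Lipschitz[of A B] by linarith
  then have "norm (A - B) * norm (A - B) \<le> (2 * M * \<tau>) * norm (A - B)"
    using \<tau> by (simp add: field_simps power2_eq_square)
  then show ?thesis using pos by (rule mult_right_le_imp_le)
qed

text \<open>
  The competitor is \<open>X = A + \<tau> V\<close> with \<open>V\<close> an optimal glide vector for minus the gradient, so that
  \<open>|V| = \<sigma>\<close> and \<open>gradE A \<bullet> V = - \<sigma>\<^sup>2\<close>. Its penalty \<open>\<tau> \<sigma>\<^sup>2 / 2\<close> uses up half of the energy gain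
  \<open>\<tau> \<sigma>\<^sup>2\<close>; the other half remains. The mean value theorem bounds the error by the oscillation
  \<open>\<eta>\<close> of the gradient over distances \<open>M \<tau>\<close>.
\<close>

lemma minimiser_dissipation:
  assumes min: "is_arg_min (\<lambda>X. (glide_dist G A X)\<^sup>2 / ereal (2 * \<tau>) + ereal (E X)) (\<lambda>_. True) B"
    and \<tau>: "0 < \<tau>"
    and osc: "\<And>X Y. norm (X - Y) \<le> M * \<tau> \<Longrightarrow> norm (gradE X - gradE Y) \<le> \<eta>"
  shows "E B - E A + (norm (A - B))\<^sup>2 / (2 * \<tau>) + \<tau> / 2 * (polar_size G (gradE A))\<^sup>2 \<le> \<tau> * (M * \<eta>)"
proof -
  define \<sigma> where "\<sigma> = polar_size G (gradE A)"
  obtain V where V: "\<And>i. V $ i \<in> glide_lines G" "norm V = polar_size G (- gradE A)"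
    "(- gradE A) \<bullet> V = (polar_size G (- gradE A))\<^sup>2"
    using optimal_glide_vector[OF G] by blast
  have nV: "norm V = \<sigma>" and gV: "gradE A \<bullet> V = - \<sigma>\<^sup>2"
    using V by (simp_all add: polar_size_uminus[OF G] \<sigma>_def)
  have \<sigma>: "0 \<le> \<sigma>" "\<sigma> \<le> M"
    using polar_size_nonneg[OF G] polar_size_le_norm[OF G, of "gradE A"] M[of A] by (auto simp: \<sigma>_def)
  define X where "X = A + \<tau> *\<^sub>R V"
  have "(A - X) $ i \<in> glide_lines G" for i
    using V(1)[of i] by (simp add: X_def glide_lines_uminus glide_lines_scaleR)
  from glide_minimiser_le[OF min \<tau> G this]
  have "(norm (A - B))\<^sup>2 / (2 * \<tau>) + E B \<le> (\<tau> * \<sigma>)\<^sup>2 / (2 * \<tau>) + E X"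
    using \<tau> nV by (simp add: X_def)
  also have "(\<tau> * \<sigma>)\<^sup>2 / (2 * \<tau>) = \<tau> / 2 * \<sigma>\<^sup>2"
    using \<tau> by (simp add: power2_eq_square field_simps)
  finally have 1: "(norm (A - B))\<^sup>2 / (2 * \<tau>) + E B \<le> \<tau> / 2 * \<sigma>\<^sup>2 + E X" .
  obtain s where s: "0 < s" "s < 1" "E X - E A = (X - A) \<bullet> gradE (A + s *\<^sub>R (X - A))"
    by (rule GDERIV_mvt[OF E])
  define Y where "Y = A + s *\<^sub>R (X - A)"
  have "norm (Y - A) = s * (\<tau> * \<sigma>)" using s \<tau> nV by (simp add: Y_def X_def)
  also have "\<dots> \<le> 1 * (\<tau> * M)" using s \<tau> \<sigma> by (intro mult_mono) auto
  finally have "norm (gradE Y - gradE A) \<le> \<eta>" by (intro osc) (simp add: mult.commute)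
  then have "V \<bullet> (gradE Y - gradE A) \<le> M * \<eta>"
    using norm_cauchy_schwarz[of V "gradE Y - gradE A"] nV \<sigma>
      mult_mono[of \<sigma> M "norm (gradE Y - gradE A)" \<eta>] M_nonneg by simp
  then have "V \<bullet> gradE Y \<le> M * \<eta> - \<sigma>\<^sup>2"
    using gV by (simp add: inner_diff_right inner_commute)
  then have "\<tau> * (V \<bullet> gradE Y) \<le> \<tau> * (M * \<eta> - \<sigma>\<^sup>2)" using \<tau> by (intro mult_left_mono) auto
  moreover have "E X - E A = \<tau> * (V \<bullet> gradE Y)"
    using s(3) unfolding Y_def[symmetric] by (simp add: X_def)
  ultimately show ?thesis using 1 by (simp add: \<sigma>_def[symmetric] algebra_simps)
qed

section \<open>Dissipation along the discrete trajectory\<close>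

context
  fixes z :: "nat \<Rightarrow> (real^2)^'n" and K :: nat and \<tau> :: real
  assumes z: "\<And>k. k < K \<Longrightarrow> is_arg_min
      (\<lambda>X. (glide_dist G (z k) X)\<^sup>2 / ereal (2 * \<tau>) + ereal (E X)) (\<lambda>_. True) (z (Suc k))"
    and \<tau>: "0 < \<tau>"
begin

lemma trajectory_Lipschitz:
  assumes "k \<le> l" "l \<le> K"
  shows "norm (z l - z k) \<le> 2 * M * (real (l - k) * \<tau>)"
  using assms
proof (induction l rule: dec_induct)
  case (step l)
  have "norm (z (Suc l) - z k) \<le> norm (z (Suc l) - z l) + norm (z l - z k)"
    using norm_triangle_ineq[of "z (Suc l) - z l" "z l - z k"] by simp
  also have "\<dots> \<le> 2 * M * \<tau> + 2 * M * (real (l - k) * \<tau>)"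
    using minimiser_step_length[OF z \<tau>, of l] step by (simp add: norm_minus_commute)
  also have "\<dots> = 2 * M * (real (Suc l - k) * \<tau>)"
    using step by (simp add: of_nat_diff Suc_diff_le algebra_simps)
  finally show ?case .
qed simp

text \<open>
  Young's inequality \<open>c d \<le> d\<^sup>2 / (2 \<tau>) + c\<^sup>2 \<tau> / 2\<close> linearises the quadratic term of each step. The
  linearised terms add up by the triangle inequality, and optimising over \<open>c\<close> afterwards recovers the
  square of the total displacement.
\<close>

lemma trajectory_dissipation:
  assumes "k \<le> l" "l \<le> K" and c: "0 \<le> c"
    and osc: "\<And>X Y. norm (X - Y) \<le> M * \<tau> \<Longrightarrow> norm (gradE X - gradE Y) \<le> \<eta>"
    and m: "\<And>j. \<lbrakk>k \<le> j; j < l\<rbrakk> \<Longrightarrow> m \<le> (polar_size G (gradE (z j)))\<^sup>2"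
  shows "E (z l) - E (z k) + c * crystalline_size G (z l - z k)
    + real (l - k) * \<tau> * (m / 2 - c\<^sup>2 / 2 - M * \<eta>) \<le> 0"
  using assms(1,2) m
proof (induction l rule: dec_induct)
  case base
  show ?case using crystalline_size_glide[OF G, of "0 :: (real^2)^'n"] zero_in_glide_lines[OF G] by simp
next
  case (step l)
  define w where "w = m / 2 - c\<^sup>2 / 2 - M * \<eta>"
  define d where "d = norm (z l - z (Suc l))"
  have min: "is_arg_min (\<lambda>X. (glide_dist G (z l) X)\<^sup>2 / ereal (2 * \<tau>) + ereal (E X))
      (\<lambda>_. True) (z (Suc l))"
    using z step by simp
  have "crystalline_size G (z (Suc l) - z l) = norm (z (Suc l) - z l)"
    using glide_minimiser_lines[OF min \<tau> G]
    by (intro crystalline_size_glide[OF G]) (metis glide_lines_uminus minus_diff_eq vector_uminus_component)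
  then have size: "crystalline_size G (z (Suc l) - z k) \<le> d + crystalline_size G (z l - z k)"
    using crystalline_size_triangle[OF G, of "z (Suc l) - z l" "z l - z k"]
    by (simp add: d_def norm_minus_commute)
  have "0 \<le> (d - c * \<tau>)\<^sup>2 / (2 * \<tau>)" using \<tau> by simp
  also have "\<dots> = d\<^sup>2 / (2 * \<tau>) - c * d + c\<^sup>2 / 2 * \<tau>"
    using \<tau> by (simp add: power2_eq_square field_simps)
  finally have young: "c * d \<le> d\<^sup>2 / (2 * \<tau>) + c\<^sup>2 / 2 * \<tau>" by simp
  have "\<tau> / 2 * m \<le> \<tau> / 2 * (polar_size G (gradE (z l)))\<^sup>2"
    using step \<tau> by (intro mult_left_mono) auto
  then have one: "E (z (Suc l)) - E (z l) + c * d + \<tau> * w \<le> 0"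
    using minimiser_dissipation[OF min \<tau> osc] young by (simp add: d_def w_def algebra_simps)
  have "c * crystalline_size G (z (Suc l) - z k) \<le> c * (d + crystalline_size G (z l - z k))"
    using size c by (rule mult_left_mono)
  moreover have "E (z l) - E (z k) + c * crystalline_size G (z l - z k)
      + real (l - k) * \<tau> * w \<le> 0"
    unfolding w_def using step by simp
  moreover have "real (Suc l - k) * \<tau> * w
      = real (l - k) * \<tau> * w + \<tau> * w"
    using step(1) by (simp add: Suc_diff_le algebra_simps)
  ultimately show ?case using one unfolding distrib_left[of c d] w_def[symmetric] by linarith
qed

end

end

section \<open>Passage to the limit\<close>

text \<open>
  A variant of the Arzela--Ascoli theorem for functions with small jumps: a diagonal subsequence converges
  at all rational points, and the asymptotic Lipschitz bound extends the convergence to all points and passes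
  to the limit.
\<close>

lemma almost_Lipschitz_pointwise_limit:
  fixes F :: "nat \<Rightarrow> real \<Rightarrow> 'a::euclidean_space"
  assumes lip: "\<And>j s t. norm (F j t - F j s) \<le> C * (\<bar>t - s\<bar> + \<tau> j)"
    and \<tau>: "\<tau> \<longlonglongrightarrow> 0" and bound: "\<And>j t. norm (F j t) \<le> B" and C: "0 \<le> C"
  obtains r Y where "strict_mono (r :: nat \<Rightarrow> nat)" "\<And>t. (\<lambda>j. F (r j) t) \<longlonglongrightarrow> Y t"
    "\<And>s t. norm (Y t - Y s) \<le> C * \<bar>t - s\<bar>"
proof -
  obtain r :: "nat \<Rightarrow> nat" where r: "strict_mono r"
    and conv: "\<And>t. t \<in> \<rat> \<Longrightarrow> \<exists>l. (\<lambda>j. F (r j) t) \<longlonglongrightarrow> l"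
    using function_convergent_subsequence[OF countable_rat, of F B] bound by metis
  have \<tau>r: "(\<lambda>j. \<tau> (r j)) \<longlonglongrightarrow> 0"
    using LIMSEQ_subseq_LIMSEQ[OF \<tau> r] by (simp add: o_def)
  have "\<exists>l. (\<lambda>j. F (r j) t) \<longlonglongrightarrow> l" for t
  proof -
    have "Cauchy (\<lambda>j. F (r j) t)"
    proof (rule metric_CauchyI)
      fix e :: real assume e: "0 < e"
      define d where "d = e / (8 * (C + 1))"
      have d: "0 < d" "C * (2 * d) \<le> e / 4" using e C by (auto simp: d_def field_simps)
      obtain q where q: "q \<in> \<rat>" "t < q" "q < t + d" using Rats_dense_in_real[of t "t + d"] d by auto
      have "Cauchy (\<lambda>j. F (r j) q)" using conv[OF q(1)] convergent_Cauchy convergent_def by blast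
      then obtain N1 where N1: "\<And>i j. \<lbrakk>i \<ge> N1; j \<ge> N1\<rbrakk> \<Longrightarrow> dist (F (r i) q) (F (r j) q) < e / 4"
        using e metric_CauchyD[of "\<lambda>j. F (r j) q" "e / 4"] by auto
      obtain N2 where N2: "\<And>j. j \<ge> N2 \<Longrightarrow> \<bar>\<tau> (r j)\<bar> < d"
        using LIMSEQ_D[OF \<tau>r d(1)] by auto
      have near: "dist (F (r j) t) (F (r j) q) \<le> e / 4" if "j \<ge> N2" for j
      proof -
        have "dist (F (r j) t) (F (r j) q) \<le> C * (\<bar>t - q\<bar> + \<tau> (r j))"
          using lip by (simp add: dist_norm)
        also have "\<dots> \<le> C * (2 * d)" using N2[OF that] q C by (intro mult_left_mono) auto
        finally show ?thesis using d by linarith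
      qed
      have "dist (F (r i) t) (F (r j) t) < e" if "i \<ge> max N1 N2" "j \<ge> max N1 N2" for i j
      proof -
        have "dist (F (r i) t) (F (r j) t)
            \<le> dist (F (r i) t) (F (r i) q) + (dist (F (r i) q) (F (r j) q) + dist (F (r j) t) (F (r j) q))"
          by (meson add_left_mono dist_triangle dist_triangle2 order_trans)
        then show ?thesis using near[of i] near[of j] N1[of i j] that e by auto
      qed
      then show "\<exists>N. \<forall>i\<ge>N. \<forall>j\<ge>N. dist (F (r i) t) (F (r j) t) < e" by blast
    qed
    then show ?thesis using Cauchy_convergent convergent_def by blast
  qed
  then obtain Y where Y: "\<And>t. (\<lambda>j. F (r j) t) \<longlonglongrightarrow> Y t" by metis
  have "norm (Y t - Y s) \<le> C * \<bar>t - s\<bar>" for s t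
  proof (rule LIMSEQ_le)
    show "(\<lambda>j. norm (F (r j) t - F (r j) s)) \<longlonglongrightarrow> norm (Y t - Y s)"
      by (intro tendsto_intros Y)
    have "(\<lambda>j. C * (\<bar>t - s\<bar> + \<tau> (r j))) \<longlonglongrightarrow> C * (\<bar>t - s\<bar> + 0)"
      by (intro tendsto_intros \<tau>r)
    then show "(\<lambda>j. C * (\<bar>t - s\<bar> + \<tau> (r j))) \<longlonglongrightarrow> C * \<bar>t - s\<bar>" by simp
  qed (use lip in auto)
  with r Y that show ?thesis by blast
qed

text \<open>
  The index selected at time \<open>t\<close> is the one whose grid time is the first not before \<open>t\<close>.
\<close>

lemma step_index_bounds:
  assumes "0 < \<tau>" "0 \<le> t"
  shows "t \<le> real (nat \<lceil>t / \<tau>\<rceil>) * \<tau>" "real (nat \<lceil>t / \<tau>\<rceil>) * \<tau> < t + \<tau>"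
proof -
  have "0 \<le> t / \<tau>" using assms by simp
  then have eq: "real (nat \<lceil>t / \<tau>\<rceil>) = of_int \<lceil>t / \<tau>\<rceil>"
    by (metis ceiling_mono ceiling_zero of_nat_nat)
  have "t / \<tau> \<le> real (nat \<lceil>t / \<tau>\<rceil>)" "real (nat \<lceil>t / \<tau>\<rceil>) < t / \<tau> + 1"
    unfolding eq by linarith+
  then show "t \<le> real (nat \<lceil>t / \<tau>\<rceil>) * \<tau>" "real (nat \<lceil>t / \<tau>\<rceil>) * \<tau> < t + \<tau>"
    using assms(1) by (simp_all add: pos_divide_le_eq field_simps)
qed

lemma step_index_mono: "\<lbrakk>0 < \<tau>; s \<le> t\<rbrakk> \<Longrightarrow> nat \<lceil>s / \<tau>\<rceil> \<le> nat \<lceil>t / \<tau>\<rceil>"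
  by (intro nat_mono ceiling_mono divide_right_mono) auto

lemma step_index_tendsto:
  assumes "\<And>j. 0 < \<tau> j" "\<tau> \<longlonglongrightarrow> 0" "0 \<le> t"
  shows "(\<lambda>j. real (nat \<lceil>t / \<tau> j\<rceil>) * \<tau> j) \<longlonglongrightarrow> t"
proof (rule tendsto_sandwich[of "\<lambda>_. t" _ _ "\<lambda>j. t + \<tau> j"])
  show "(\<lambda>j. t + \<tau> j) \<longlonglongrightarrow> t" using tendsto_add[OF tendsto_const assms(2), of t] by simp
  show "(\<lambda>j. t) \<longlonglongrightarrow> t" by simp
qed (use step_index_bounds[OF assms(1,3)] in \<open>auto intro: always_eventually less_imp_le\<close>)

locale approximating_schemes = bounded_gradient_energy G E gradE M
  for G and E :: "(real^2)^'n \<Rightarrow> real" and gradE M +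
  fixes Z0 :: "(real^2)^'n" and T :: real and \<tau> :: "nat \<Rightarrow> real" and z :: "nat \<Rightarrow> nat \<Rightarrow> (real^2)^'n"
  assumes T: "0 < T" and uc: "uniformly_continuous_on UNIV gradE"
    and \<tau>_pos: "\<And>j. 0 < \<tau> j" and \<tau>_lim: "\<tau> \<longlonglongrightarrow> 0"
    and z: "\<And>j. minimising_movement G E Z0 T (\<tau> j) (z j)"
begin

lemma z_min:
  "k < nat \<lceil>T / \<tau> j\<rceil> \<Longrightarrow> is_arg_min
      (\<lambda>X. (glide_dist G (z j k) X)\<^sup>2 / ereal (2 * \<tau> j) + ereal (E X)) (\<lambda>_. True) (z j (Suc k))"
  using z by (auto simp: minimising_movement_def)

lemma step_curve_almost_Lipschitz:
  assumes "0 \<le> s" "s \<le> t" "t \<le> T"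
  shows "norm (step_curve (\<tau> j) (z j) t - step_curve (\<tau> j) (z j) s) \<le> 2 * M * ((t - s) + \<tau> j)"
proof -
  let ?k = "nat \<lceil>s / \<tau> j\<rceil>" and ?l = "nat \<lceil>t / \<tau> j\<rceil>"
  have kl: "?k \<le> ?l" "?l \<le> nat \<lceil>T / \<tau> j\<rceil>" using step_index_mono[OF \<tau>_pos] assms by blast+
  have "norm (z j ?l - z j ?k) \<le> 2 * M * (real (?l - ?k) * \<tau> j)"
    by (rule trajectory_Lipschitz[of "nat \<lceil>T / \<tau> j\<rceil>" "z j" "\<tau> j", OF z_min \<tau>_pos kl])
  also have "real (?l - ?k) * \<tau> j \<le> (t - s) + \<tau> j"
    using step_index_bounds[of "\<tau> j" t] step_index_bounds[of "\<tau> j" s] \<tau>_pos[of j] assms kl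
    by (simp add: of_nat_diff left_diff_distrib)
  finally show ?thesis using M_nonneg by (simp add: step_curve_def mult_left_mono)
qed

text \<open>
  Times are clamped to \<open>[0, T]\<close>, so that the limit is a Lipschitz curve on the whole line.
\<close>

lemma convergent_subsequence:
  obtains r Y where "strict_mono (r :: nat \<Rightarrow> nat)"
    "\<And>t. t \<in> {0..T} \<Longrightarrow> (\<lambda>j. step_curve (\<tau> (r j)) (z (r j)) t) \<longlonglongrightarrow> Y t"
    "\<And>s t. norm (Y t - Y s) \<le> 2 * M * \<bar>t - s\<bar>"
proof -
  define cl where "cl t = max 0 (min T t)" for t
  have cl: "0 \<le> cl t" "cl t \<le> T" "\<bar>cl t - cl s\<bar> \<le> \<bar>t - s\<bar>" for s t
    using T by (auto simp: cl_def)
  define F where "F j t = step_curve (\<tau> j) (z j) (cl t)" for j t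
  have lip0: "norm (F j t - F j s) \<le> 2 * M * (\<bar>t - s\<bar> + \<tau> j)" if "cl s \<le> cl t" for j s t
  proof -
    have "norm (F j t - F j s) \<le> 2 * M * ((cl t - cl s) + \<tau> j)"
      unfolding F_def using cl that by (intro step_curve_almost_Lipschitz)
    also have "\<dots> \<le> 2 * M * (\<bar>t - s\<bar> + \<tau> j)"
      using cl(3)[of t s] M_nonneg by (intro mult_left_mono) auto
    finally show ?thesis .
  qed
  have lip: "norm (F j t - F j s) \<le> 2 * M * (\<bar>t - s\<bar> + \<tau> j)" for j s t
    using lip0[of s t j] lip0[of t s j] by (metis abs_minus_commute linear norm_minus_commute)
  obtain b where b: "\<And>j. \<bar>\<tau> j\<bar> \<le> b"
    using \<tau>_lim convergent_imp_Bseq[of \<tau>] unfolding convergent_def Bseq_def by auto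
  have bound: "norm (F j t) \<le> norm Z0 + 2 * M * (T + b)" for j t
  proof -
    have "F j 0 = Z0" using z[of j] T by (simp add: F_def cl_def step_curve_def minimising_movement_def)
    then have "norm (F j t) \<le> norm Z0 + norm (F j t - F j 0)"
      using norm_triangle_ineq[of Z0 "F j t - Z0"] by simp
    also have "norm (F j t - F j 0) \<le> 2 * M * ((cl t - cl 0) + \<tau> j)"
      unfolding F_def using cl T by (intro step_curve_almost_Lipschitz) (auto simp: cl_def)
    also have "\<dots> \<le> 2 * M * (T + b)"
      using cl(2)[of t] cl(1)[of 0] b[of j] M_nonneg by (intro mult_left_mono) auto
    finally show ?thesis by simp
  qed
  obtain r Y where rY: "strict_mono (r :: nat \<Rightarrow> nat)" "\<And>t. (\<lambda>j. F (r j) t) \<longlonglongrightarrow> Y t"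
    "\<And>s t. norm (Y t - Y s) \<le> 2 * M * \<bar>t - s\<bar>"
    using almost_Lipschitz_pointwise_limit[OF lip \<tau>_lim bound] M_nonneg by auto
  show ?thesis
  proof (rule that[OF rY(1) _ rY(3)])
    fix t assume "t \<in> {0..T}"
    then have "cl t = t" by (simp add: cl_def)
    with rY(2)[of t] show "(\<lambda>j. step_curve (\<tau> (r j)) (z (r j)) t) \<longlonglongrightarrow> Y t"
      by (simp add: F_def)
  qed
qed

lemma continuous_E: "continuous_on UNIV E"
  using E has_derivative_continuous unfolding gderiv_def continuous_on_eq_continuous_at[OF open_UNIV] by blast

lemma continuous_slope: "continuous_on UNIV (\<lambda>X. polar_size G (gradE X))"
  by (rule continuous_on_compose2[OF continuous_polar_size[OF G]
      uniformly_continuous_imp_continuous[OF uc]]) auto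

text \<open>
  Uniform continuity of the gradient keeps the slope almost constant along the discrete trajectory between
  the times \<open>s\<close> and \<open>t\<close>, so the summed estimate can be written with the slope at time \<open>s\<close> alone, and
  every term passes to the limit by continuity.
\<close>

lemma limit_dissipation:
  assumes conv: "\<And>t. t \<in> {0..T} \<Longrightarrow> (\<lambda>j. step_curve (\<tau> j) (z j) t) \<longlonglongrightarrow> Y t" and e: "0 < e"
  obtains \<delta> where "0 < \<delta>" "\<And>s t. \<lbrakk>0 \<le> s; s < t; t \<le> T; t - s < \<delta>\<rbrakk> \<Longrightarrow>
    E (Y t) - E (Y s) + (crystalline_size G (Y t - Y s))\<^sup>2 / (2 * (t - s))
      + (t - s) / 2 * (polar_size G (gradE (Y s)))\<^sup>2 \<le> e * (t - s)"
proof -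
  define \<eta> where "\<eta> = e / (2 * (M + 1))"
  have \<eta>: "0 < \<eta>" "2 * M * \<eta> \<le> e" using e M_nonneg by (auto simp: \<eta>_def field_simps)
  obtain \<rho> where \<rho>: "0 < \<rho>" "\<And>X Y. norm (X - Y) < \<rho> \<Longrightarrow> norm (gradE X - gradE Y) < \<eta>"
    using uc \<eta>(1) unfolding uniformly_continuous_on_def dist_norm by (metis UNIV_I)
  have slope_osc: "(polar_size G (gradE X))\<^sup>2 - 2 * M * \<eta> \<le> (polar_size G (gradE X'))\<^sup>2"
    if "norm (X - X') < \<rho>" for X X'
  proof -
    let ?a = "polar_size G (gradE X)" and ?b = "polar_size G (gradE X')"
    have ab: "0 \<le> ?a" "0 \<le> ?b" "?a \<le> M" "?b \<le> M"
      using polar_size_nonneg[OF G] polar_size_le_norm[OF G] M order_trans by blast+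
    have "?a\<^sup>2 - ?b\<^sup>2 = (?a - ?b) * (?a + ?b)" by (simp add: power2_eq_square algebra_simps)
    also have "\<dots> \<le> \<eta> * (?a + ?b)"
      using abs_polar_size_diff_le[OF G, of "gradE X" "gradE X'"] \<rho>(2)[OF that] ab
      by (intro mult_right_mono) auto
    also have "\<dots> \<le> \<eta> * (2 * M)" using ab \<eta>(1) by (intro mult_left_mono) auto
    finally show ?thesis by (simp add: algebra_simps)
  qed
  define \<delta> where "\<delta> = \<rho> / (4 * (M + 1))"
  have \<delta>: "0 < \<delta>" "4 * M * \<delta> < \<rho>" using \<rho>(1) M_nonneg by (auto simp: \<delta>_def field_simps)
  show ?thesis
  proof (rule that[OF \<delta>(1)])
    fix s t assume st: "0 \<le> s" "s < t" "t \<le> T" "t - s < \<delta>"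
    let ?k = "\<lambda>j. nat \<lceil>s / \<tau> j\<rceil>" and ?l = "\<lambda>j. nat \<lceil>t / \<tau> j\<rceil>"
    let ?Y = "\<lambda>t j. step_curve (\<tau> j) (z j) t"
    have kl: "?k j \<le> ?l j" "?l j \<le> nat \<lceil>T / \<tau> j\<rceil>" for j
      using step_index_mono[OF \<tau>_pos] st less_imp_le by blast+
    have len: "real (?l j - ?k j) * \<tau> j \<le> (t - s) + \<tau> j" for j
      using step_index_bounds[of "\<tau> j" t] step_index_bounds[of "\<tau> j" s] \<tau>_pos[of j] st kl[of j]
      by (simp add: of_nat_diff left_diff_distrib)
    have lims: "?Y t \<longlonglongrightarrow> Y t" "?Y s \<longlonglongrightarrow> Y s" using conv st by auto
    have len_lim: "(\<lambda>j. real (?l j - ?k j) * \<tau> j) \<longlonglongrightarrow> t - s"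
    proof -
      have "(\<lambda>j. real (?l j) * \<tau> j - real (?k j) * \<tau> j) \<longlonglongrightarrow> t - s"
        using st by (intro tendsto_diff step_index_tendsto \<tau>_pos \<tau>_lim) auto
      then show ?thesis by (simp only: of_nat_diff[OF kl(1)] left_diff_distrib)
    qed
    \<comment> \<open>The choice that is optimal in the limiting linearised inequality.\<close>
    define c where "c = crystalline_size G (Y t - Y s) / (t - s)"
    have c: "0 \<le> c" using st crystalline_size_nonneg[OF G, of "Y t - Y s"] by (simp add: c_def)
    define A where "A j = E (?Y t j) - E (?Y s j) + c * crystalline_size G (?Y t j - ?Y s j)
        + real (?l j - ?k j) * \<tau> j *
          (((polar_size G (gradE (?Y s j)))\<^sup>2 - 2 * M * \<eta>) / 2 - c\<^sup>2 / 2 - M * \<eta>)" for j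
    have "A \<longlonglongrightarrow> E (Y t) - E (Y s) + c * crystalline_size G (Y t - Y s)
        + (t - s) * (((polar_size G (gradE (Y s)))\<^sup>2 - 2 * M * \<eta>) / 2 - c\<^sup>2 / 2 - M * \<eta>)"
      unfolding A_def
      by (intro tendsto_intros len_lim lims
          continuous_on_tendsto_compose[OF continuous_E]
          continuous_on_tendsto_compose[OF continuous_slope]
          continuous_on_tendsto_compose[OF continuous_crystalline_size[OF G]]) auto
    moreover have "\<forall>\<^sub>F j in sequentially. A j \<le> 0"
    proof -
      have "\<forall>\<^sub>F j in sequentially. \<tau> j < \<delta>" using order_tendstoD(2)[OF \<tau>_lim \<delta>(1)] .
      then show ?thesis
      proof eventually_elim
        case (elim j)
        have bnd: "M * \<tau> j < \<rho>" "2 * M * ((t - s) + \<tau> j) < \<rho>"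
        proof -
          have "2 * M * ((t - s) + \<tau> j) \<le> 2 * M * (\<delta> + \<delta>)"
            using elim st M_nonneg by (intro mult_left_mono) auto
          with \<delta>(2) show "2 * M * ((t - s) + \<tau> j) < \<rho>" by simp
          moreover have "M * \<tau> j \<le> M * (2 * ((t - s) + \<tau> j))"
            using \<tau>_pos[of j] st M_nonneg by (intro mult_left_mono) auto
          ultimately show "M * \<tau> j < \<rho>" by (simp add: mult.left_commute mult.assoc)
        qed
        show "A j \<le> 0"
          unfolding A_def step_curve_def
        proof (rule trajectory_dissipation[of "nat \<lceil>T / \<tau> j\<rceil>" "z j" "\<tau> j", OF z_min \<tau>_pos kl c])
          show "norm (gradE X - gradE Y) \<le> \<eta>" if "norm (X - Y) \<le> M * \<tau> j" for X Y
            using \<rho>(2)[of X Y] that bnd by linarith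
          fix i assume i: "?k j \<le> i" "i < ?l j"
          have "norm (z j i - z j (?k j)) \<le> 2 * M * (real (i - ?k j) * \<tau> j)"
            using i kl by (intro trajectory_Lipschitz[of "nat \<lceil>T / \<tau> j\<rceil>" "z j" "\<tau> j", OF z_min \<tau>_pos]) (auto intro: order_trans less_imp_le)
          also have "\<dots> \<le> 2 * M * (real (?l j - ?k j) * \<tau> j)"
            using i M_nonneg \<tau>_pos[of j] by (intro mult_left_mono mult_right_mono) auto
          also have "\<dots> \<le> 2 * M * ((t - s) + \<tau> j)" using len M_nonneg by (intro mult_left_mono) auto
          finally have "norm (z j (?k j) - z j i) < \<rho>" using bnd by (simp add: norm_minus_commute)
          then show "(polar_size G (gradE (z j (?k j))))\<^sup>2 - 2 * M * \<eta> \<le> (polar_size G (gradE (z j i)))\<^sup>2"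
            by (rule slope_osc)
        qed
      qed
    qed
    ultimately have lim: "E (Y t) - E (Y s) + c * crystalline_size G (Y t - Y s)
        + (t - s) * (((polar_size G (gradE (Y s)))\<^sup>2 - 2 * M * \<eta>) / 2 - c\<^sup>2 / 2 - M * \<eta>) \<le> 0"
      by (rule tendsto_upperbound) simp
    have young: "c * crystalline_size G (Y t - Y s) - (t - s) * (c\<^sup>2 / 2)
        = (crystalline_size G (Y t - Y s))\<^sup>2 / (2 * (t - s))"
    proof -
      have "a / h * a - h * ((a / h)\<^sup>2 / 2) = a\<^sup>2 / (2 * h)" if "0 < h" for a h :: real
        using that by (simp add: power2_eq_square field_simps)
      then show ?thesis using st by (simp add: c_def)
    qed
    have "(t - s) * (2 * M * \<eta>) \<le> (t - s) * e" using st \<eta>(2) by (intro mult_left_mono) auto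
    moreover have "(t - s) * (((polar_size G (gradE (Y s)))\<^sup>2 - 2 * M * \<eta>) / 2 - c\<^sup>2 / 2 - M * \<eta>)
        = (t - s) / 2 * (polar_size G (gradE (Y s)))\<^sup>2 - (t - s) * (c\<^sup>2 / 2) - (t - s) * (2 * M * \<eta>)"
      by (simp add: field_simps)
    ultimately show "E (Y t) - E (Y s) + (crystalline_size G (Y t - Y s))\<^sup>2 / (2 * (t - s))
      + (t - s) / 2 * (polar_size G (gradE (Y s)))\<^sup>2 \<le> e * (t - s)"
      using lim young unfolding mult.commute[of e] by linarith
  qed
qed

end

section \<open>Integrating the local dissipation inequality\<close>

text \<open>
  The integral of a difference telescopes: only the two boundary layers of width \<open>h\<close> remain.
\<close>

lemma integral_shift_difference:
  fixes e :: "real \<Rightarrow> real"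
  assumes cont: "continuous_on UNIV e" and h: "0 < h" "h < T"
  shows "((\<lambda>t. e t - e (t + h)) has_integral (integral {0..h} e - integral {T - h..T} e)) {0..T - h}"
proof -
  have int: "e integrable_on {a..b}" for a b
    by (rule integrable_continuous_interval) (rule continuous_on_subset[OF cont], simp)
  have cont_h: "continuous_on {0..T - h} (\<lambda>t. e (t + h))"
    by (rule continuous_on_compose2[OF cont]) (auto intro!: continuous_intros)
  have "integral {0..T - h} (\<lambda>t. e (t + h)) = integral {h..T} e"
    using integral_shift[of 0 h "T - h" e] continuous_on_subset[OF cont] by (simp add: o_def)
  moreover have "integral {0..T - h} e + integral {T - h..T} e = integral {0..h} e + integral {h..T} e"
    using Henstock_Kurzweil_Integration.integral_combine[OF _ _ int, of 0 "T - h" T]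
      Henstock_Kurzweil_Integration.integral_combine[OF _ _ int, of 0 h T] h by simp
  ultimately have "integral {0..T - h} e - integral {0..T - h} (\<lambda>t. e (t + h))
      = integral {0..h} e - integral {T - h..T} e" by simp
  then show ?thesis
    using has_integral_diff[OF integrable_integral[OF int[of 0 "T - h"]]
        integrable_integral[OF integrable_continuous_interval[OF cont_h]]] by simp
qed

lemma eventually_boundary_averages:
  fixes e :: "real \<Rightarrow> real"
  assumes cont: "continuous_on UNIV e" and \<epsilon>: "0 < \<epsilon>"
  shows "\<forall>\<^sub>F h in at_right 0. integral {0..h} e - integral {T - h..T} e \<le> h * (e 0 - e T + 2 * \<epsilon>)"
proof -
  have int: "e integrable_on {a..b}" for a b
    by (rule integrable_continuous_interval) (rule continuous_on_subset[OF cont], simp)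
  obtain d where d: "0 < d" "\<And>x. \<bar>x\<bar> < d \<Longrightarrow> \<bar>e x - e 0\<bar> < \<epsilon>"
    using cont \<epsilon> unfolding continuous_on_iff dist_real_def by (metis UNIV_I diff_zero)
  obtain d' where d': "0 < d'" "\<And>x. \<bar>x - T\<bar> < d' \<Longrightarrow> \<bar>e x - e T\<bar> < \<epsilon>"
    using cont \<epsilon> unfolding continuous_on_iff dist_real_def by (metis UNIV_I)
  have "integral {0..h} e - integral {T - h..T} e \<le> h * (e 0 - e T + 2 * \<epsilon>)"
    if h: "0 < h" "h < min d d'" for h
  proof -
    have "integral {0..h} e \<le> integral {0..h} (\<lambda>_. e 0 + \<epsilon>)"
    proof (rule integral_le[OF int])
      show "e x \<le> e 0 + \<epsilon>" if "x \<in> {0..h}" for x using d(2)[of x] that h by auto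
    qed (rule integrable_const_ivl)
    moreover have "integral {T - h..T} (\<lambda>_. e T - \<epsilon>) \<le> integral {T - h..T} e"
    proof (rule integral_le[OF _ int])
      show "e T - \<epsilon> \<le> e x" if "x \<in> {T - h..T}" for x using d'(2)[of x] that h by auto
    qed (rule integrable_const_ivl)
    ultimately show ?thesis using h by (simp add: algebra_simps)
  qed
  then show ?thesis
    unfolding eventually_at_right_field using d(1) d'(1) by (intro exI[of _ "min d d'"]) auto
qed

text \<open>
  Divided by \<open>h\<close> and integrated over \<open>[0, T - h]\<close>, the local inequality at \<open>t = s + h\<close> bounds the
  integral of \<open>(v s (s + h))\<^sup>2 + p s\<close> by boundary averages of \<open>e\<close>, which tend to
  \<open>2 (e 0 - e T)\<close>. Fatou's lemma then gives the bound for the limits \<open>m s\<close>.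
\<close>

lemma integrated_dissipation:
  fixes e m p :: "real \<Rightarrow> real" and v :: "real \<Rightarrow> real \<Rightarrow> real"
  assumes T: "0 < T" and cont: "continuous_on UNIV e"
    and diss: "\<And>\<epsilon>. 0 < \<epsilon> \<Longrightarrow> \<exists>\<delta>>0. \<forall>s t. 0 \<le> s \<longrightarrow> s < t \<longrightarrow> t \<le> T \<longrightarrow> t - s < \<delta> \<longrightarrow>
        e t - e s + (t - s) / 2 * ((v s t)\<^sup>2 + p s) \<le> \<epsilon> * (t - s)"
    and p: "\<And>s. 0 \<le> p s" "p \<in> borel_measurable lebesgue"
    and v: "\<And>h. 0 < h \<Longrightarrow> (\<lambda>s. v s (s + h)) \<in> borel_measurable lebesgue"
    and lim: "AE s in lebesgue. (v s \<longlongrightarrow> m s) (at_right s)"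
  shows "e T \<le> e 0"
    and "(\<integral>\<^sup>+ s. ennreal ((m s)\<^sup>2 + p s) \<partial>lebesgue_on {0<..<T}) \<le> ennreal (2 * (e 0 - e T))"
proof -
  define u where "u h s = ennreal ((v s (s + h))\<^sup>2 + p s) * indicator {0<..<T - h} s" for h s
  define B where "B \<epsilon> = 2 * (e 0 - e T) + (4 + 2 * T) * \<epsilon>" for \<epsilon>
  have key: "\<forall>\<^sub>F h in at_right 0. 0 \<le> B \<epsilon> \<and> (\<integral>\<^sup>+ s. u h s \<partial>lebesgue) \<le> ennreal (B \<epsilon>)"
    if \<epsilon>: "0 < \<epsilon>" for \<epsilon>
  proof -
    obtain \<delta> where \<delta>: "0 < \<delta>" "\<And>s t. \<lbrakk>0 \<le> s; s < t; t \<le> T; t - s < \<delta>\<rbrakk> \<Longrightarrow>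
        e t - e s + (t - s) / 2 * ((v s t)\<^sup>2 + p s) \<le> \<epsilon> * (t - s)"
      using diss[OF \<epsilon>] by blast
    have "\<forall>\<^sub>F h in at_right 0. 0 < h \<and> h < min \<delta> T"
      unfolding eventually_at_right_field using \<delta>(1) T by (intro exI[of _ "min \<delta> T"]) auto
    with eventually_boundary_averages[OF cont \<epsilon>, of T] show ?thesis
    proof eventually_elim
      case (elim h)
      then have h: "0 < h" "h < \<delta>" "h < T" by auto
      define g where "g s = 2 / h * (e s - e (s + h)) + 2 * \<epsilon>" for s
      define I where "I = integral {0..h} e - integral {T - h..T} e"
      have vg: "(v s (s + h))\<^sup>2 + p s \<le> g s" if "s \<in> {0..T - h}" for s
      proof -
        have "e (s + h) - e s + h / 2 * ((v s (s + h))\<^sup>2 + p s) \<le> \<epsilon> * h"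
          using \<delta>(2)[of s "s + h"] that h by simp
        then show ?thesis using h by (simp add: g_def field_simps)
      qed
      have g0: "0 \<le> g s" if "s \<in> {0..T - h}" for s
        using vg[OF that] p(1)[of s] zero_le_power2[of "v s (s + h)"] by linarith
      have gint: "(g has_integral (2 / h * I + 2 * \<epsilon> * (T - h))) {0..T - h}"
        unfolding g_def I_def
        using has_integral_add[OF has_integral_mult_right[OF integral_shift_difference[OF cont h(1,3)], of "2 / h"]
            has_integral_const_real[of "2 * \<epsilon>" 0 "T - h"]] h by (simp add: mult.commute)
      have "2 / h * I \<le> 2 / h * (h * (e 0 - e T + 2 * \<epsilon>))"
        using elim h by (intro mult_left_mono) (auto simp: I_def)
      also have "\<dots> = 2 * (e 0 - e T) + 4 * \<epsilon>" using h by (simp add: field_simps)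
      finally have le: "2 / h * I + 2 * \<epsilon> * (T - h) \<le> B \<epsilon>"
        using mult_pos_pos[OF \<epsilon> h(1)] by (simp add: B_def algebra_simps)
      have "(\<integral>\<^sup>+ s. u h s \<partial>lebesgue) \<le> (\<integral>\<^sup>+ s. ennreal (g s) * indicator {0..T - h} s \<partial>lebesgue)"
        unfolding u_def using vg by (intro nn_integral_mono) (auto simp: indicator_def intro: ennreal_leI)
      also have "\<dots> = ennreal (2 / h * I + 2 * \<epsilon> * (T - h))"
        unfolding nn_integral_completion
        by (rule nn_integral_has_integral_lebesgue'[OF g0 gint])
      also have "\<dots> \<le> ennreal (B \<epsilon>)" using le by (rule ennreal_leI)
      finally show ?case using has_integral_nonneg[OF gint g0] le by simp
    qed
  qed
  have B0: "0 \<le> B \<epsilon>" if "0 < \<epsilon>" for \<epsilon>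
    using eventually_happens[OF key[OF that]] by simp
  have small: "x \<le> 2 * (e 0 - e T)" if "\<And>\<epsilon>. 0 < \<epsilon> \<Longrightarrow> x \<le> B \<epsilon>" for x
  proof (rule field_le_epsilon)
    fix \<epsilon> :: real assume "0 < \<epsilon>"
    then show "x \<le> 2 * (e 0 - e T) + \<epsilon>"
      using that[of "\<epsilon> / (4 + 2 * T)"] T by (simp add: B_def)
  qed
  show mono: "e T \<le> e 0" using small[OF B0] by simp
  define h where "h n = 1 / real (Suc n)" for n
  have h0: "0 < h n" for n by (simp add: h_def)
  have h_lim: "filterlim h (at_right 0) sequentially"
    unfolding filterlim_at using h0 LIMSEQ_Suc[OF lim_1_over_n]
    by (auto simp: h_def[abs_def])
  have u_meas: "u (h n) \<in> borel_measurable lebesgue" for n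
    unfolding u_def[abs_def]
    by (intro borel_measurable_times_ennreal borel_measurable_indicator
        measurable_compose[OF _ measurable_ennreal] borel_measurable_add borel_measurable_power
        v[OF h0] p(2)) simp
  have "(\<integral>\<^sup>+ s. ennreal ((m s)\<^sup>2 + p s) \<partial>lebesgue_on {0<..<T})
      = (\<integral>\<^sup>+ s. ennreal ((m s)\<^sup>2 + p s) * indicator {0<..<T} s \<partial>lebesgue)"
    by (rule nn_integral_restrict_space) simp
  also have "\<dots> = (\<integral>\<^sup>+ s. liminf (\<lambda>n. u (h n) s) \<partial>lebesgue)"
  proof (rule nn_integral_cong_AE, use lim in eventually_elim)
    case (elim s)
    show ?case
    proof (cases "s \<in> {0<..<T}")
      case True
      have "filterlim (\<lambda>n. s + h n) (at_right s) sequentially"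
        using h_lim unfolding filterlim_at by (auto intro!: tendsto_eq_intros)
      with elim have "(\<lambda>n. v s (s + h n)) \<longlonglongrightarrow> m s" by (rule filterlim_compose)
      then have 1: "(\<lambda>n. ennreal ((v s (s + h n))\<^sup>2 + p s)) \<longlonglongrightarrow> ennreal ((m s)\<^sup>2 + p s)"
        by (intro tendsto_intros)
      have "\<forall>\<^sub>F n in sequentially. h n < T - s"
        using h_lim True unfolding filterlim_at by (intro order_tendstoD(2)) auto
      then have "\<forall>\<^sub>F n in sequentially. ennreal ((v s (s + h n))\<^sup>2 + p s) = u (h n) s"
        by eventually_elim (use True in \<open>auto simp: u_def\<close>)
      with 1 have "(\<lambda>n. u (h n) s) \<longlonglongrightarrow> ennreal ((m s)\<^sup>2 + p s)"
        by (rule Lim_transform_eventually)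
      then have "liminf (\<lambda>n. u (h n) s) = ennreal ((m s)\<^sup>2 + p s)"
        by (intro lim_imp_Liminf) auto
      with True show ?thesis by simp
    next
      case False
      have "u (h n) s = 0" for n using False h0[of n] by (auto simp: u_def indicator_def)
      with False show ?thesis by (simp add: Liminf_const)
    qed
  qed
  also have "\<dots> \<le> liminf (\<lambda>n. \<integral>\<^sup>+ s. u (h n) s \<partial>lebesgue)"
    by (rule nn_integral_liminf[OF u_meas])
  finally have J: "(\<integral>\<^sup>+ s. ennreal ((m s)\<^sup>2 + p s) \<partial>lebesgue_on {0<..<T})
      \<le> liminf (\<lambda>n. \<integral>\<^sup>+ s. u (h n) s \<partial>lebesgue)" (is "?J \<le> ?L") .
  have JB: "?J \<le> ennreal (B \<epsilon>)" if "0 < \<epsilon>" for \<epsilon>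
  proof -
    have "\<forall>\<^sub>F n in sequentially. (\<integral>\<^sup>+ s. u (h n) s \<partial>lebesgue) \<le> ennreal (B \<epsilon>)"
      using eventually_compose_filterlim[OF key[OF that] h_lim] by eventually_elim simp
    then have "?L \<le> limsup (\<lambda>n. \<integral>\<^sup>+ s. u (h n) s \<partial>lebesgue)"
      "limsup (\<lambda>n. \<integral>\<^sup>+ s. u (h n) s \<partial>lebesgue) \<le> ennreal (B \<epsilon>)"
      by (auto intro: Liminf_le_Limsup Limsup_bounded)
    with J show ?thesis by order
  qed
  obtain j where j: "0 \<le> j" "?J = ennreal j"
    using JB[of 1] by (cases ?J) (auto simp: top_unique)
  have "j \<le> 2 * (e 0 - e T)"
    by (rule small) (use JB B0 in \<open>auto simp: j\<close>)
  then show "?J \<le> ennreal (2 * (e 0 - e T))" using j by (simp add: ennreal_leI)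
qed

section \<open>Metric derivatives of Lipschitz curves\<close>

lemma Lipschitz_imp_absolutely_continuous_curve:
  assumes lip: "\<And>s t. dist (f s) (f t) \<le> C * \<bar>s - t\<bar>" and C: "0 \<le> C"
  shows "absolutely_continuous_curve I f"
  unfolding absolutely_continuous_curve_def
proof (intro allI impI)
  fix \<epsilon> :: real assume \<epsilon>: "0 < \<epsilon>"
  have sum_less: "(\<Sum>i<k. dist (f (a i)) (f (b i))) < \<epsilon>"
    if ab: "\<forall>i<k. a i \<le> b i" and small: "(\<Sum>i<k. b i - a i) < \<epsilon> / (C + 1)" for k :: nat and a b
  proof -
    have "(\<Sum>i<k. dist (f (a i)) (f (b i))) \<le> (\<Sum>i<k. C * (b i - a i))"
      using lip ab by (intro sum_mono) (metis abs_minus_commute abs_of_nonneg diff_ge_0_iff_ge lessThan_iff)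
    also have "\<dots> \<le> (C + 1) * (\<Sum>i<k. b i - a i)"
      unfolding sum_distrib_left[symmetric] using ab by (intro mult_right_mono sum_nonneg) auto
    also have "\<dots> < \<epsilon>" using small C by (simp add: field_simps)
    finally show ?thesis .
  qed
  show "\<exists>\<delta>>0. \<forall>(m::nat) a b. (\<forall>i<m. a i \<le> b i \<and> {a i..b i} \<subseteq> I) \<and>
      disjoint_family_on (\<lambda>i. {a i<..<b i}) {..<m} \<and> (\<Sum>i<m. b i - a i) < \<delta> \<longrightarrow>
      (\<Sum>i<m. dist (f (a i)) (f (b i))) < \<epsilon>"
  proof (intro exI[of _ "\<epsilon> / (C + 1)"] conjI allI impI)
    show "0 < \<epsilon> / (C + 1)" using \<epsilon> C by simp
    fix m :: nat and a b
    assume H: "(\<forall>i<m. a i \<le> b i \<and> {a i..b i} \<subseteq> I) \<and>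
      disjoint_family_on (\<lambda>i. {a i<..<b i}) {..<m} \<and> (\<Sum>i<m. b i - a i) < \<epsilon> / (C + 1)"
    show "(\<Sum>i<m. dist (f (a i)) (f (b i))) < \<epsilon>"
      by (rule sum_less) (use H in blast)+
  qed
qed

context
  fixes G :: "(real^2) set" and Y :: "real \<Rightarrow> (real^2)^'n" and C :: real
  assumes G: "glide_directions G" and Y: "\<And>s t. norm (Y t - Y s) \<le> C * \<bar>t - s\<bar>"
begin

lemma continuous_Lipschitz_curve: "continuous_on UNIV Y"
proof -
  have "0 \<le> C" using order_trans[OF norm_ge_zero Y[of 1 0]] by simp
  then show ?thesis
    by (intro lipschitz_on_continuous_on[of C] lipschitz_onI) (use Y in \<open>auto simp: dist_norm\<close>)
qed

text \<open>
  Each of the finitely many coordinates is a scalar Lipschitz function and has a right derivative almost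
  everywhere. The crystalline norm is continuous and positively homogeneous, so its quotient converges at
  every common point of right differentiability.
\<close>

lemma metric_quotient_tendsto_AE:
  "AE t in lebesgue. \<exists>l. (metric_quotient G Y t \<longlongrightarrow> l) (at_right t)"
proof -
  have "AE t in lebesgue. \<forall>i k. \<exists>l. ((\<lambda>h. (Y (t + h) $ i $ k - Y t $ i $ k) / h) \<longlongrightarrow> l) (at_right 0)"
  proof (intro AE_all_countable[THEN iffD2] allI)
    fix i k
    show "AE t in lebesgue. \<exists>l. ((\<lambda>h. (Y (t + h) $ i $ k - Y t $ i $ k) / h) \<longlongrightarrow> l) (at_right 0)"
    proof (rule Lipschitz_right_derivative_AE)
      fix s t
      have "\<bar>Y s $ i $ k - Y t $ i $ k\<bar> \<le> norm ((Y s - Y t) $ i)"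
        using component_le_norm_cart[of "(Y s - Y t) $ i" k] by simp
      also have "\<dots> \<le> norm (Y s - Y t)" by (rule Finite_Cartesian_Product.norm_nth_le)
      also have "\<dots> \<le> C * \<bar>s - t\<bar>" by (rule Y)
      finally show "\<bar>Y s $ i $ k - Y t $ i $ k\<bar> \<le> C * \<bar>s - t\<bar>" .
    qed
  qed
  then show ?thesis
  proof eventually_elim
    case (elim t)
    define V where "V = (\<chi> i. \<chi> k. SOME l. ((\<lambda>h. (Y (t + h) $ i $ k - Y t $ i $ k) / h) \<longlongrightarrow> l) (at_right 0))"
    have L: "((\<lambda>h. (Y (t + h) $ i $ k - Y t $ i $ k) / h) \<longlongrightarrow> V $ i $ k) (at_right 0)" for i k
      using someI_ex[OF elim[rule_format, of i k]] by (simp add: V_def)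
    have "((\<lambda>h. (1 / h) *\<^sub>R (Y (t + h) - Y t)) \<longlongrightarrow> V) (at_right 0)"
      by (intro vec_tendstoI) (use L in simp)
    then have "((\<lambda>h. crystalline_size G ((1 / h) *\<^sub>R (Y (t + h) - Y t))) \<longlongrightarrow> crystalline_size G V) (at_right 0)"
      by (rule continuous_on_tendsto_compose[OF continuous_crystalline_size[OF G]]) auto
    moreover have "\<forall>\<^sub>F h in at_right 0. crystalline_size G ((1 / h) *\<^sub>R (Y (t + h) - Y t))
        = metric_quotient G Y t (h + t)"
      using eventually_at_right_less[of "0::real"]
      by eventually_elim
        (simp add: crystalline_size_scale[OF G] metric_quotient_def crystalline_dist_size add.commute)
    ultimately have "((\<lambda>h. metric_quotient G Y t (h + t)) \<longlongrightarrow> crystalline_size G V) (at_right 0)"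
      by (rule Lim_transform_eventually)
    then show ?case unfolding filterlim_at_right_to_0[of _ _ t] by blast
  qed
qed

lemma right_metric_derivative_tendsto_AE:
  "AE t in lebesgue. (metric_quotient G Y t \<longlongrightarrow> right_metric_derivative G Y t) (at_right t)"
  using metric_quotient_tendsto_AE
  by eventually_elim (auto simp: right_metric_derivative_def tendsto_Lim)

lemma measurable_metric_quotient:
  "(\<lambda>t. metric_quotient G Y t (t + h)) \<in> borel_measurable lebesgue"
proof -
  have "continuous_on UNIV (\<lambda>t. crystalline_size G (Y (t + h) - Y t))"
    by (intro continuous_on_compose2[OF continuous_crystalline_size[OF G]] continuous_intros
        continuous_on_compose2[OF continuous_Lipschitz_curve]) auto
  then have "(\<lambda>t. crystalline_size G (Y (t + h) - Y t)) \<in> borel_measurable lebesgue"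
    by (intro measurable_completion) (simp add: borel_measurable_continuous_onI)
  then show ?thesis by (simp add: metric_quotient_def crystalline_dist_size)
qed

text \<open>
  Almost everywhere the derivative is the limit along the increments \<open>1 / (n + 1)\<close>, which is
  measurable; completeness of the Lebesgue measure takes care of the exceptional null set.
\<close>

lemma measurable_right_metric_derivative: "right_metric_derivative G Y \<in> borel_measurable lebesgue"
proof (rule borel_measurable_AE)
  define h where "h n = 1 / real (Suc n)" for n
  show "(\<lambda>t. lim (\<lambda>n. metric_quotient G Y t (t + h n))) \<in> borel_measurable lebesgue"
    by (intro borel_measurable_lim_metric measurable_metric_quotient)
  show "AE t in lebesgue. lim (\<lambda>n. metric_quotient G Y t (t + h n)) = right_metric_derivative G Y t"
    using right_metric_derivative_tendsto_AE
  proof eventually_elim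
    case (elim t)
    have "filterlim (\<lambda>n. t + h n) (at_right t) sequentially"
      unfolding filterlim_at using tendsto_add[OF tendsto_const LIMSEQ_Suc[OF lim_1_over_n], of t]
      by (auto simp: h_def[abs_def])
    with elim have "(\<lambda>n. metric_quotient G Y t (t + h n)) \<longlonglongrightarrow> right_metric_derivative G Y t"
      by (rule filterlim_compose)
    then show ?case by (rule limI)
  qed
qed

end

section \<open>The energy-dissipation inequality\<close>

theorem theorem3p1:
  fixes G :: "(real^2) set"
    and E :: "(real^2)^'n \<Rightarrow> real"
    and gradE :: "(real^2)^'n \<Rightarrow> (real^2)^'n"
    and Z0 :: "(real^2)^'n"
    and T :: real
    and Z :: "real \<Rightarrow> nat \<Rightarrow> (real^2)^'n"
    and \<tau> :: "nat \<Rightarrow> real"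
  assumes "glide_directions G"
    and "T > 0"
    and "\<And>X. GDERIV E X :> gradE X"
    and "continuous_on UNIV gradE"
    and "bounded (range E)" and "uniformly_continuous_on UNIV E"
    and "bounded (range gradE)" and "uniformly_continuous_on UNIV gradE"
    and "\<And>\<sigma>. \<sigma> > 0 \<Longrightarrow> minimising_movement G E Z0 T \<sigma> (Z \<sigma>)"
    and "\<And>j. \<tau> j > 0" and "\<tau> \<longlonglongrightarrow> 0"
  shows "\<exists>(r :: nat \<Rightarrow> nat) (Zhat :: real \<Rightarrow> (real^2)^'n).
      strict_mono r \<and>
      (\<forall>t\<in>{0..T}. (\<lambda>j. step_curve (\<tau> (r j)) (Z (\<tau> (r j))) t) \<longlonglongrightarrow> Zhat t) \<and>
      absolutely_continuous_curve {0..T} Zhat \<and>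
      (AE t in lebesgue_on {0<..<T}. \<exists>l. (metric_quotient G Zhat t \<longlongrightarrow> l) (at_right t)) \<and>
      right_metric_derivative G Zhat \<in> borel_measurable (lebesgue_on {0<..<T}) \<and>
      (\<lambda>t. metric_slope G E (Zhat t)) \<in> borel_measurable (lebesgue_on {0<..<T}) \<and>
      ereal (E (Zhat T) - E (Zhat 0)) +
        ereal (1 / 2) *
        enn2ereal (\<integral>\<^sup>+ t. e2ennreal (ereal ((right_metric_derivative G Zhat t)\<^sup>2)
                                   + (metric_slope G E (Zhat t))\<^sup>2) \<partial>lebesgue_on {0<..<T})
        \<le> 0"
proof -
  obtain M where M: "\<And>X. norm (gradE X) \<le> M" using assms(7) unfolding bounded_iff by blast
  interpret S: approximating_schemes G E gradE M Z0 T \<tau> "\<lambda>j. Z (\<tau> j)"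
    by (unfold_locales, rule assms(1), rule assms(3), rule M, rule assms(2), rule assms(8),
        rule assms(10), rule assms(11), rule assms(9)[OF assms(10)])
  obtain r Y where r: "strict_mono (r :: nat \<Rightarrow> nat)"
    and conv: "\<And>t. t \<in> {0..T} \<Longrightarrow> (\<lambda>j. step_curve (\<tau> (r j)) (Z (\<tau> (r j))) t) \<longlonglongrightarrow> Y t"
    and lip: "\<And>s t. norm (Y t - Y s) \<le> 2 * M * \<bar>t - s\<bar>"
    by (rule S.convergent_subsequence, rule that)
  interpret R: approximating_schemes G E gradE M Z0 T "\<lambda>j. \<tau> (r j)" "\<lambda>j. Z (\<tau> (r j))"
    by (unfold_locales, rule assms(2), rule assms(8), rule assms(10),
        rule LIMSEQ_subseq_LIMSEQ[OF assms(11) r, unfolded o_def], rule assms(9)[OF assms(10)])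
  note G = assms(1)
  define p where "p t = (polar_size G (gradE (Y t)))\<^sup>2" for t
  have cont: "continuous_on UNIV Y" by (rule continuous_Lipschitz_curve[OF G lip])
  have cont_E: "continuous_on UNIV (\<lambda>t. E (Y t))"
    by (rule continuous_on_compose2[OF S.continuous_E cont]) simp
  have cont_s: "continuous_on UNIV (\<lambda>t. polar_size G (gradE (Y t)))"
    by (rule continuous_on_compose2[OF S.continuous_slope cont]) simp
  have slope: "metric_slope G E (Y t) = ereal (polar_size G (gradE (Y t)))" for t
    by (rule metric_slope_eq_polar_size[OF G assms(3)])
  have meas_s: "(\<lambda>t. polar_size G (gradE (Y t))) \<in> borel_measurable lebesgue"
    using cont_s by (intro measurable_completion) (simp add: borel_measurable_continuous_onI)
  have local_dissipation: "\<exists>\<delta>>0. \<forall>s t. 0 \<le> s \<longrightarrow> s < t \<longrightarrow> t \<le> T \<longrightarrow> t - s < \<delta> \<longrightarrow>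
      E (Y t) - E (Y s) + (t - s) / 2 * ((metric_quotient G Y s t)\<^sup>2 + p s) \<le> \<epsilon> * (t - s)"
    if \<epsilon>: "0 < \<epsilon>" for \<epsilon>
  proof -
    obtain \<delta> where \<delta>: "0 < \<delta>" "\<And>s t. \<lbrakk>0 \<le> s; s < t; t \<le> T; t - s < \<delta>\<rbrakk> \<Longrightarrow>
      E (Y t) - E (Y s) + (crystalline_size G (Y t - Y s))\<^sup>2 / (2 * (t - s))
        + (t - s) / 2 * (polar_size G (gradE (Y s)))\<^sup>2 \<le> \<epsilon> * (t - s)"
      using R.limit_dissipation[OF conv \<epsilon>] by blast
    have quot: "(t - s) / 2 * (metric_quotient G Y s t)\<^sup>2
        = (crystalline_size G (Y t - Y s))\<^sup>2 / (2 * (t - s))" if "s < t" for s t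
    proof -
      have "h / 2 * (a / h)\<^sup>2 = a\<^sup>2 / (2 * h)" if "0 < h" for a h :: real
        using that by (simp add: power2_eq_square field_simps)
      then show ?thesis using that by (simp add: metric_quotient_def crystalline_dist_size)
    qed
    show ?thesis
    proof (intro exI[of _ \<delta>] conjI allI impI \<delta>(1))
      fix s t assume st: "0 \<le> s" "s < t" "t \<le> T" "t - s < \<delta>"
      show "E (Y t) - E (Y s) + (t - s) / 2 * ((metric_quotient G Y s t)\<^sup>2 + p s) \<le> \<epsilon> * (t - s)"
        using \<delta>(2)[OF st] quot[OF st(2)] unfolding p_def distrib_left by linarith
    qed
  qed
  have p: "0 \<le> p t" "p \<in> borel_measurable lebesgue" for t
    unfolding p_def[abs_def] by (simp, rule borel_measurable_power[OF meas_s])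
  note dissipation = integrated_dissipation[where v = "metric_quotient G Y" and p = p
      and e = "\<lambda>t. E (Y t)" and m = "right_metric_derivative G Y",
      OF assms(2) cont_E local_dissipation p
      measurable_metric_quotient[OF G lip] right_metric_derivative_tendsto_AE[OF G lip]]
  let ?J = "\<integral>\<^sup>+ t. e2ennreal (ereal ((right_metric_derivative G Y t)\<^sup>2)
      + (metric_slope G E (Y t))\<^sup>2) \<partial>lebesgue_on {0<..<T}"
  have "?J = (\<integral>\<^sup>+ t. ennreal ((right_metric_derivative G Y t)\<^sup>2 + p t) \<partial>lebesgue_on {0<..<T})"
    by (simp add: slope p_def)
  then have J: "?J \<le> ennreal (2 * (E (Y 0) - E (Y T)))" using dissipation(2) by simp
  have ineq: "ereal (E (Y T) - E (Y 0)) + ereal (1 / 2) * enn2ereal ?J \<le> 0"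
  proof -
    obtain j where j: "0 \<le> j" "?J = ennreal j" using J by (cases ?J) (auto simp: top_unique)
    have "j \<le> 2 * (E (Y 0) - E (Y T))"
      using J dissipation(1) unfolding j(2) by (simp add: ennreal_le_iff)
    then show ?thesis unfolding j(2) using j(1) by simp
  qed
  have "AE t in lebesgue_on {0<..<T}. \<exists>l. (metric_quotient G Y t \<longlongrightarrow> l) (at_right t)"
    using metric_quotient_tendsto_AE[OF G lip] by (subst AE_restrict_space_iff) auto
  moreover have "right_metric_derivative G Y \<in> borel_measurable (lebesgue_on {0<..<T})"
    by (rule measurable_restrict_space1[OF measurable_right_metric_derivative[OF G lip]])
  moreover have "(\<lambda>t. metric_slope G E (Y t)) \<in> borel_measurable (lebesgue_on {0<..<T})"
    unfolding slope by (intro measurable_restrict_space1 borel_measurable_ereal meas_s)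
  moreover have "absolutely_continuous_curve {0..T} Y"
    by (rule Lipschitz_imp_absolutely_continuous_curve[of _ "2 * M"])
      (use lip S.M_nonneg in \<open>auto simp: dist_norm\<close>)
  ultimately show ?thesis using r conv ineq by blast
qed

end
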